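(* Let $P,Q$ be real polynomials in $n$ variables with $P\not\equiv 0$ and $Q\not\equiv 0$. Suppose there is an open set $\Delta\subseteq\mathbb{R}^n$ with $\vec 0\in\Delta\cap\mathcal{Z}(Q)\subseteq\Delta\cap\mathcal{Z}(P)$. Then there exist $r_1>0$ and positive integers $p,e$ such that for every open ball $B_r=B_r(\vec 0)$ with $0<r\le r_1$, the rational function $P^{2p}/Q^{2e}$ is bounded on $B_r$, and the function $s:B_r\to\mathbb{R}$, $$s(\vec x)=\begin{cases}\dfrac{(P(\vec x))^{2p}}{(Q(\vec x))^{2e}} & \text{for }\vec x\in B_r\setminus\mathcal{Z}(Q),\\[2mm] 0 & \text{for }\vec x\in B_r\cap\mathcal{Z}(Q),\end{cases}$$ is not continuous on $B_r$. Moreover, the ratio $p/e$ is unique in the following sense: if $p_0,q_0$ are positive integers such that the rational function $P^{2p_0}/Q^{2q_0}$ is bounded on some ball $B_{r_2}(\vec 0)$, $r_2>0$, and for every $r\in(0,r_2]$ the function on $B_r(\vec 0)$ equal to $(P(\vec x))^{2p_0}/(Q(\vec x))^{2q_0}$ for $\vec x\in B_r(\vec 0)\setminus\mathcal{Z}(Q)$ and equal to $0$ for $\vec x\in B_r(\vec 0)\cap\mathcal{Z}(Q)$ is not continuous on $B_r(\vec 0)$, then $p_0/q_0=p/e$.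
   Context: For a real polynomial $F$ in $n$ variables, $\mathcal{Z}(F)=\{\vec x\in\mathbb{R}^n: F(\vec x)=0\}$. $B_r(\vec x_0)$ denotes the open Euclidean ball of radius $r$ and center $\vec x_0$ in $\mathbb{R}^n$. A rational function $P/Q$ is an expression with $P,Q$ polynomials and $Q\not\equiv 0$ (common factors are allowed and not canceled); its domain is $\mathbb{R}^n\setminus\mathcal{Z}(Q)$. It is bounded on a set $\Delta$ if there is a constant $M$ with $|P(\vec x)/Q(\vec x)|\le M$ for all $\vec x\in\Delta\setminus\mathcal{Z}(Q)$. *)

theory Defs
  imports "HOL-Analysis.Analysis"
begin

text \<open>A real polynomial in \<open>n\<close> variables is a function on \<open>real ^ 'n\<close> satisfying the library predicate
  \<^const>\<open>real_polynomial_function\<close>, the closure of the linear forms and constants under sums and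
  products. As the reals form an infinite field, a polynomial is determined by its function, so
  \<open>F \<noteq> (\<lambda>_. 0)\<close> expresses that \<open>F\<close> is not the zero polynomial. A rational function is a pair of a
  numerator and a denominator, so no common factors are cancelled.\<close>

definition zero_set :: "(real ^ 'n \<Rightarrow> real) \<Rightarrow> (real ^ 'n) set" where
  "zero_set F = {x. F x = 0}"

definition rational_bounded_on ::
  "(real ^ 'n \<Rightarrow> real) \<Rightarrow> (real ^ 'n \<Rightarrow> real) \<Rightarrow> (real ^ 'n) set \<Rightarrow> bool" where
  "rational_bounded_on P Q \<Delta> \<longleftrightarrow> (\<exists>M. \<forall>x \<in> \<Delta> - zero_set Q. \<bar>P x / Q x\<bar> \<le> M)"

text \<open>The continuity claims concern the restriction of this total function to balls around \<open>0\<close>.\<close>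

definition ratio_ext ::
  "(real ^ 'n \<Rightarrow> real) \<Rightarrow> (real ^ 'n \<Rightarrow> real) \<Rightarrow> nat \<Rightarrow> nat \<Rightarrow> real ^ 'n \<Rightarrow> real" where
  "ratio_ext P Q p e x = (if x \<in> zero_set Q then 0 else P x ^ (2 * p) / Q x ^ (2 * e))"

end

theory Submission
  imports Defs
begin

text \<open>Put \<open>f = P\<^sup>2\<close> and \<open>g = Q\<^sup>2\<close>, and for a small radius \<open>\<rho>\<close> let \<open>\<phi>(t)\<close> be the minimum of \<open>g\<close>
  over the points of the closed ball of radius \<open>\<rho>\<close> with \<open>f \<ge> t\<close>. By quantifier elimination over the
  reals, finitely many polynomials in \<open>\<rho>\<^sup>2\<close>, \<open>t\<close> and \<open>q\<close> suffice to provide, for each \<open>\<rho>\<close> and \<open>t\<close>, one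
  that vanishes at \<open>q = \<phi>(t)\<close> without vanishing identically in \<open>q\<close>. In a vanishing sum the two largest
  monomials are comparable, so for small \<open>t\<close> the power \<open>\<phi>(t)\<^sup>e\<close> is comparable to \<open>t\<^sup>p\<close>
  with \<open>p\<close> and \<open>e\<close> bounded independently of \<open>\<rho>\<close> and \<open>t\<close>. The largest ratio \<open>p/e\<close> that occurs for
  arbitrarily small \<open>t\<close> makes \<open>f\<^sup>p/g\<^sup>e\<close> bounded on the ball, but not convergent to \<open>0\<close>. By the
  pigeonhole principle some pair occurs for arbitrarily small \<open>\<rho>\<close>. If \<open>P\<^sup>2\<^sup>p/Q\<^sup>2\<^sup>e\<close> is bounded, then
  any pair with a larger ratio gives a continuous function, which yields uniqueness.\<close>

section \<open>Sign diagrams of finite families of univariate polynomials\<close>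

text \<open>The graph is piecewise linear, through \<open>(a, a)\<close>, \<open>(u, v)\<close> and
  \<open>(b, b)\<close>. The minimum of the two lines is concave and exceeds the identity only
  between \<open>a\<close> and \<open>b\<close>, so the maximum with the identity leaves all other
  points fixed.\<close>

lemma exists_move_up:
  fixes a b u v :: real
  assumes "a < u" "u \<le> v" "v < b"
  obtains k :: "real \<Rightarrow> real"
  where "strict_mono k" "surj k" "k u = v" "\<And>y. y \<le> a \<or> b \<le> y \<Longrightarrow> k y = y"
proof
  define l r where "l = (v - a) / (u - a)" and "r = (b - v) / (b - u)"
  have l: "1 \<le> l" and r: "0 < r" "r \<le> 1" using assms by (auto simp: l_def r_def)
  define k :: "real \<Rightarrow> real" where "k y = max y (min (a + l * (y - a)) (b - r * (b - y)))" for y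
  show "strict_mono k"
  proof (rule strict_monoI)
    fix y z :: real assume "y < z"
    then have "a + l * (y - a) < a + l * (z - a)" "b - r * (b - y) < b - r * (b - z)"
      using l r by simp_all
    then show "k y < k z" using \<open>y < z\<close> unfolding k_def by (simp add: max_def min_def)
  qed
  have "a + l * (u - a) = v" "b - r * (b - u) = v" using assms by (auto simp: l_def r_def)
  then show "k u = v" using assms(2) by (simp add: k_def)
  show out: "k y = y" if "y \<le> a \<or> b \<le> y" for y
    using that
  proof
    assume "y \<le> a"
    then have "a + l * (y - a) \<le> y" using l mult_right_mono[of 1 l "a - y"] by (simp add: algebra_simps)
    then show ?thesis by (simp add: k_def)
  next
    assume "b \<le> y"
    then have "b - r * (b - y) \<le> y" using r mult_right_mono[of r 1 "y - b"] by (simp add: algebra_simps)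
    then show ?thesis by (simp add: k_def)
  qed
  have "\<exists>x. min a y \<le> x \<and> x \<le> max b y \<and> k x = y" for y
  proof (rule IVT')
    show "continuous_on {min a y..max b y} k" unfolding k_def by (intro continuous_intros)
  qed (use out[of "min a y"] out[of "max b y"] assms in auto)
  then show "surj k" by (metis surjI)
qed

lemma exists_move:
  fixes a b u v :: real
  assumes "a < u" "u < b" "a < v" "v < b"
  obtains k :: "real \<Rightarrow> real"
  where "strict_mono k" "surj k" "k u = v" "\<And>y. y \<le> a \<or> b \<le> y \<Longrightarrow> k y = y"
proof (cases "u \<le> v")
  case True
  then show ?thesis using exists_move_up[of a u v b] assms that by blast
next
  case False
  \<comment> \<open>A downward move is the inverse of the upward move from \<open>v\<close> to
    \<open>u\<close>.\<close>
  then obtain k :: "real \<Rightarrow> real" where k: "strict_mono k" "surj k" "k v = u"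
    "\<And>y. y \<le> a \<or> b \<le> y \<Longrightarrow> k y = y"
    using exists_move_up[of a v u b] assms by (metis linorder_linear)
  have inj: "inj k" using k(1) by (rule strict_mono_imp_inj_on)
  show ?thesis
  proof (rule that)
    show "strict_mono (inv k)"
      using k(1,2) by (intro strict_monoI) (metis strict_mono_less surj_f_inv_f)
    show "surj (inv k)" using inj by (rule inj_imp_surj_inv)
    show "inv k u = v" using inj k(3) by (metis inv_f_f)
    show "inv k y = y" if "y \<le> a \<or> b \<le> y" for y using inj k(4)[OF that] by (metis inv_f_f)
  qed
qed

lemma strict_mono_on_extend_surj:
  fixes g :: "real \<Rightarrow> real"
  assumes "finite A" "strict_mono_on A g"
  shows "\<exists>h. strict_mono h \<and> surj h \<and> (\<forall>a\<in>A. h a = g a)"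
  using assms
proof (induction A rule: finite_induct)
  case empty
  show ?case by (intro exI[of _ id]) (auto simp: strict_mono_def)
next
  case (insert w A)
  have "strict_mono_on A g" using insert.prems by (auto simp: strict_mono_on_def)
  then obtain h where h: "strict_mono h" "surj h" and hg: "\<And>a. a \<in> A \<Longrightarrow> h a = g a"
    using insert.IH by blast
  \<comment> \<open>The inserted number keeps the set nonempty when no point of \<open>A\<close>
    lies on this side of \<open>w\<close>; the offset by 1 keeps it strictly below
    \<open>h w\<close> and \<open>g w\<close>. The set \<open>R\<close> is built likewise.\<close>
  define L where "L = insert (min (h w) (g w) - 1) (h ` {z\<in>A. z < w})"
  define R where "R = insert (max (h w) (g w) + 1) (h ` {z\<in>A. w < z})"
  have fin: "finite L" "finite R" using insert.hyps by (auto simp: L_def R_def)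
  have gw: "h z < g w" if "z \<in> A" "z < w" for z
    using that insert.prems hg unfolding strict_mono_on_def by (metis insertCI)
  have wg: "g w < h z" if "z \<in> A" "w < z" for z
    using that insert.prems hg unfolding strict_mono_on_def by (metis insertCI)
  have "l < h w \<and> l < g w" if "l \<in> L" for l
    using that gw h(1) by (auto simp: L_def strict_mono_less)
  moreover have "Max L \<in> L" using fin by (intro Max_in) (auto simp: L_def)
  ultimately have L: "Max L < h w" "Max L < g w" by blast+
  have "h w < l \<and> g w < l" if "l \<in> R" for l
    using that wg h(1) by (auto simp: R_def strict_mono_less)
  moreover have "Min R \<in> R" using fin by (intro Min_in) (auto simp: R_def)
  ultimately have R: "h w < Min R" "g w < Min R" by blast+
  obtain k where k: "strict_mono k" "surj k" "k (h w) = g w"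
    and kid: "\<And>y. y \<le> Max L \<or> Min R \<le> y \<Longrightarrow> k y = y"
    using exists_move[OF L(1) R(1) L(2) R(2)] by blast
  have "k (h a) = g a" if "a \<in> A" for a
  proof -
    have "a < w \<or> w < a" using that insert.hyps by (metis linorder_neqE)
    then have "h a \<in> L \<or> h a \<in> R" using that by (auto simp: L_def R_def)
    then have "h a \<le> Max L \<or> Min R \<le> h a" using fin by auto
    then show ?thesis using kid hg that by simp
  qed
  then have "\<forall>a\<in>insert w A. (k \<circ> h) a = g a" using k(3) by simp
  moreover have "strict_mono (k \<circ> h)" using k(1) h(1) by (simp add: strict_mono_def)
  moreover have "surj (k \<circ> h)" using h(2) k(2) by (rule comp_surj)
  ultimately show ?case by blast
qed

section \<open>Signs of a univariate polynomial and of its derivative\<close>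

lemma poly_sgn_eq_between:
  fixes p :: "real poly"
  assumes "u \<le> v" "\<And>c. u \<le> c \<Longrightarrow> c \<le> v \<Longrightarrow> poly p c \<noteq> 0"
  shows "sgn (poly p u) = sgn (poly p v)"
proof (rule ccontr)
  assume ne: "sgn (poly p u) \<noteq> sgn (poly p v)"
  have nz: "poly p u \<noteq> 0" "poly p v \<noteq> 0" using assms by auto
  have "u < v" using ne assms(1) by (cases "u = v") auto
  moreover have "poly p u * poly p v < 0" 
    using ne nz by (auto simp: sgn_real_def mult_less_0_iff split: if_splits)
  ultimately obtain c where "u < c" "c < v" "poly p c = 0" using poly_IVT by blast
  then show False using assms(2)[of c] by simp
qed

lemma poly_sgn_diff:
  fixes p :: "real poly"
  assumes "u < v" "\<And>c. u < c \<Longrightarrow> c < v \<Longrightarrow> sgn (poly (pderiv p) c) = s"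
  shows "sgn (poly p v - poly p u) = s"
proof -
  obtain c where "u < c" "c < v" "poly p v - poly p u = (v - u) * poly (pderiv p) c"
    using poly_MVT[OF assms(1)] by blast
  then show ?thesis using assms by (simp add: sgn_mult)
qed

text \<open>The derivative determines the sign of the leading coefficient, and this is the sign of
  \<open>p\<close> far to the right. It replaces the right endpoint in the intermediate value
  argument when there are no further roots on that side.\<close>

lemma poly_eventually_sgn_pderiv:
  fixes p :: "real poly"
  assumes "\<And>c. u < c \<Longrightarrow> sgn (poly (pderiv p) c) = s" "s \<noteq> 0"
  shows "\<exists>v>u. sgn (poly p v) = s"
proof -
  have pos: "\<exists>v>u. poly p v > 0" if d: "\<And>c. u < c \<Longrightarrow> poly (pderiv p) c > 0" for p :: "real poly"
  proof -
    have "pderiv p \<noteq> 0" using d[of "u + 1"] by auto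
    then have deg: "degree p > 0" by (simp add: pderiv_eq_0_iff)
    have "\<not> lead_coeff p < 0"
    proof
      assume "lead_coeff p < 0"
      then have "lead_coeff (- pderiv p) > 0"
        using deg by (simp add: degree_pderiv coeff_pderiv mult_less_0_iff)
      then obtain n where n: "\<forall>x\<ge>n. poly (- pderiv p) x \<ge> lead_coeff (- pderiv p)"
        using poly_pinfty_gt_lc by blast
      then have "poly (- pderiv p) (max n (u + 1)) > 0" 
        using \<open>lead_coeff (- pderiv p) > 0\<close> by (meson max.cobounded1 order_less_le_trans)
      moreover have "u < max n (u + 1)" by simp
      ultimately show False using d[of "max n (u + 1)"] by simp
    qed
    moreover have "lead_coeff p \<noteq> 0" using deg by auto
    ultimately have lc: "lead_coeff p > 0" by linarith
    then obtain n where n: "\<forall>x\<ge>n. poly p x \<ge> lead_coeff p"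
      using poly_pinfty_gt_lc by blast
    then have "poly p (max n (u + 1)) > 0" using lc by (meson max.cobounded1 order_less_le_trans)
    then show ?thesis by (intro exI[of _ "max n (u + 1)"]) auto
  qed
  consider "s = 1" | "s = -1" using assms(1)[of "u + 1"] assms(2)
    by (auto simp: sgn_real_def split: if_splits)
  then show ?thesis
  proof cases
    case 1
    then show ?thesis using pos[of p] assms by (auto simp: sgn_1_pos)
  next
    case 2
    then show ?thesis using pos[of "- p"] assms by (auto simp: sgn_1_neg pderiv_minus)
  qed
qed

lemma poly_eventually_sgn_pderiv_left:
  fixes p :: "real poly"
  assumes "\<And>c. c < u \<Longrightarrow> sgn (poly (pderiv p) c) = s" "s \<noteq> 0"
  shows "\<exists>v<u. sgn (poly p v) = - s"
proof -
  define q where "q = p \<circ>\<^sub>p [:0, -1:]"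
  have "sgn (poly (pderiv q) c) = - s" if "-u < c" for c
    using that assms(1)[of "-c"]
      by (simp add: q_def pderiv_pcompose poly_pcompose pderiv_pCons sgn_minus)
  then obtain v where "v > - u" "sgn (poly q v) = - s"
    using poly_eventually_sgn_pderiv[of "-u" q "-s"] assms(2) by auto
  then show ?thesis by (intro exI[of _ "- v"]) (auto simp: q_def poly_pcompose)
qed

lemma poly_sgn_eq_on_interval:
  fixes p :: "real poly"
  assumes "\<And>c. min u v \<le> c \<Longrightarrow> c \<le> max u v \<Longrightarrow> poly p c \<noteq> 0"
  shows "sgn (poly p u) = sgn (poly p v)"
proof (cases "u \<le> v")
  case True
  then show ?thesis using assms by (intro poly_sgn_eq_between) simp_all
next
  case False
  then have "sgn (poly p v) = sgn (poly p u)" using assms by (intro poly_sgn_eq_between) simp_all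
  then show ?thesis by simp
qed

text \<open>A nonzero value at \<open>a\<close> keeps its sign as long as there are no roots; from a
  zero at \<open>a\<close>, the polynomial leaves in the direction of its derivative.\<close>

lemma poly_sgn_right_of:
  fixes p :: "real poly"
  assumes "a < y" "\<And>c. a < c \<Longrightarrow> c \<le> y \<Longrightarrow> poly p c \<noteq> 0 \<and> poly (pderiv p) c \<noteq> 0"
  shows "sgn (poly p y) = (if poly p a = 0 then sgn (poly (pderiv p) y) else sgn (poly p a))"
proof (cases "poly p a = 0")
  case True
  have "sgn (poly p y - poly p a) = sgn (poly (pderiv p) y)"
  proof (rule poly_sgn_diff[OF assms(1)])
    show "sgn (poly (pderiv p) c) = sgn (poly (pderiv p) y)" if "a < c" "c < y" for c
      using that assms(2) by (intro poly_sgn_eq_between) auto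
  qed
  then show ?thesis using True by simp
next
  case False
  then have "poly p c \<noteq> 0" if "a \<le> c" "c \<le> y" for c
    using that assms(2)[of c] by (cases "c = a") auto
  then show ?thesis using False poly_sgn_eq_between[of a y p] assms(1) by simp
qed

text \<open>Far to the left \<open>p\<close> and its derivative have opposite signs, and neither
  changes sign up to \<open>y\<close>.\<close>

lemma poly_sgn_leftmost:
  fixes p :: "real poly"
  assumes "\<And>c. c \<le> y \<Longrightarrow> poly p c \<noteq> 0 \<and> poly (pderiv p) c \<noteq> 0"
  shows "sgn (poly p y) = - sgn (poly (pderiv p) y)"
proof -
  have "sgn (poly (pderiv p) c) = sgn (poly (pderiv p) y)" if "c < y" for c
    using that assms by (intro poly_sgn_eq_between) auto
  moreover have "sgn (poly (pderiv p) y) \<noteq> 0" using assms[of y] by (simp add: sgn_zero_iff)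
  ultimately obtain v where v: "v < y" "sgn (poly p v) = - sgn (poly (pderiv p) y)"
    using poly_eventually_sgn_pderiv_left[of y p] by blast
  have "sgn (poly p v) = sgn (poly p y)" using v(1) assms by (intro poly_sgn_eq_between) auto
  then show ?thesis using v(2) by simp
qed

text \<open>The derivative has no roots in the gap of \<open>Z\<close> around \<open>w\<close>, so
  \<open>P\<close> is strictly monotone there and has opposite signs at the ends. The map
  \<open>h\<close> carries these signs to \<open>P'\<close>, which therefore has a root in the
  corresponding gap. At an unbounded end the behaviour at infinity supplies the sign.\<close>

lemma poly_root_transfer:
  fixes P P' :: "real poly" and h :: "real \<Rightarrow> real"
  assumes h: "strict_mono h" "surj h" and "finite Z"
    and dz: "\<And>y. poly (pderiv P) y = 0 \<Longrightarrow> y \<in> Z"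
    and ds: "\<And>y. sgn (poly (pderiv P) y) = sgn (poly (pderiv P') (h y))"
    and zs: "\<And>z. z \<in> Z \<Longrightarrow> sgn (poly P z) = sgn (poly P' (h z))"
    and w: "poly P w = 0" "w \<notin> Z"
  shows "\<exists>v. poly P' v = 0 \<and> (\<forall>z\<in>Z. (z < w \<longrightarrow> h z < v) \<and> (w < z \<longrightarrow> v < h z))"
proof -
  \<comment> \<open>The derivative has this constant sign on the whole gap of \<open>Z\<close>
    around \<open>w\<close>, and so does the derivative of \<open>P'\<close> on the image of the
    gap.\<close>
  define s where "s = sgn (poly (pderiv P) w)"
  have s0: "s \<noteq> 0" using dz[of w] w(2) by (auto simp: s_def sgn_zero_iff)
  have ds': "sgn (poly (pderiv P') c) = s" 
    if "c = h c'" "\<And>z. z \<in> Z \<Longrightarrow> z < min w c' \<or> max w c' < z" for c c'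
  proof -
    have "sgn (poly (pderiv P) w) = sgn (poly (pderiv P) c')"
    proof (rule poly_sgn_eq_on_interval)
      fix y assume "min w c' \<le> y" "y \<le> max w c'"
      then show "poly (pderiv P) y \<noteq> 0" using that(2)[of y] dz[of y] by linarith
    qed
    then show ?thesis using ds[of c'] that(1) by (simp add: s_def)
  qed
  have ds: "sgn (poly (pderiv P) c) = s" if "\<And>z. z \<in> Z \<Longrightarrow> z < min w c \<or> max w c < z" for c
    using ds'[OF refl that] ds[of c] by simp
  \<comment> \<open>The right endpoint is the image of the next point of \<open>Z\<close>, or a
    point far to the right if there is none. The left endpoint below is found symmetrically.\<close>
  have "\<exists>b>h w. (\<forall>z\<in>Z. w < z \<longrightarrow> b \<le> h z) \<and> sgn (poly P' b) = s"
  proof (cases "\<exists>z\<in>Z. w < z")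
    case True
    define e where "e = Min {z\<in>Z. w < z}"
    have "e \<in> {z\<in>Z. w < z}" unfolding e_def using True \<open>finite Z\<close> by (intro Min_in) auto
    then have e: "e \<in> Z" "w < e" by auto
    have le: "e \<le> z" if "z \<in> Z" "w < z" for z
      unfolding e_def using that \<open>finite Z\<close> by (intro Min_le) auto
    have "sgn (poly P e - poly P w) = s"
    proof (rule poly_sgn_diff[OF e(2)])
      fix c assume "w < c" "c < e"
      have "z < min w c \<or> max w c < z" if "z \<in> Z" for z
      proof -
        have "z \<noteq> w" using that w(2) by auto
        then have "z < w \<or> e \<le> z" using le[OF that] by linarith
        then show ?thesis using \<open>w < c\<close> \<open>c < e\<close> by auto
      qed
      then show "sgn (poly (pderiv P) c) = s" by (rule ds)
    qed
    then have "sgn (poly P' (h e)) = s" using zs[OF e(1)] w by simp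
    then show ?thesis using e le h(1)
      by (intro exI[of _ "h e"]) (auto simp: strict_mono_less strict_mono_less_eq)
  next
    case False
    have "sgn (poly (pderiv P') c) = s" if "h w < c" for c
    proof -
      obtain c' where c': "c = h c'" using h(2) by (metis surjD)
      then have "w < c'" using that h(1) by (simp add: strict_mono_less)
      have "z < min w c' \<or> max w c' < z" if "z \<in> Z" for z
      proof -
        have "z \<noteq> w" "\<not> w < z" using that False w(2) by auto
        then show ?thesis using \<open>w < c'\<close> by auto
      qed
      then show ?thesis by (rule ds'[OF c'])
    qed
    then show ?thesis using poly_eventually_sgn_pderiv[of "h w" P' s] s0 False by blast
  qed
  then obtain b where b: "h w < b" "\<And>z. z \<in> Z \<Longrightarrow> w < z \<Longrightarrow> b \<le> h z" "sgn (poly P' b) = s" by blast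
  have "\<exists>a<h w. (\<forall>z\<in>Z. z < w \<longrightarrow> h z \<le> a) \<and> sgn (poly P' a) = - s"
  proof (cases "\<exists>z\<in>Z. z < w")
    case True
    define e where "e = Max {z\<in>Z. z < w}"
    have "e \<in> {z\<in>Z. z < w}" unfolding e_def using True \<open>finite Z\<close> by (intro Max_in) auto
    then have e: "e \<in> Z" "e < w" by auto
    have le: "z \<le> e" if "z \<in> Z" "z < w" for z
      unfolding e_def using that \<open>finite Z\<close> by (intro Max_ge) auto
    have "sgn (poly P w - poly P e) = s"
    proof (rule poly_sgn_diff[OF e(2)])
      fix c assume "e < c" "c < w"
      have "z < min w c \<or> max w c < z" if "z \<in> Z" for z
      proof -
        have "z \<noteq> w" using that w(2) by auto
        then have "w < z \<or> z \<le> e" using le[OF that] by linarith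
        then show ?thesis using \<open>e < c\<close> \<open>c < w\<close> by auto
      qed
      then show "sgn (poly (pderiv P) c) = s" by (rule ds)
    qed
    then have "sgn (poly P' (h e)) = - s" using zs[OF e(1)] w by (simp add: sgn_minus)
    then show ?thesis using e le h(1)
      by (intro exI[of _ "h e"]) (auto simp: strict_mono_less strict_mono_less_eq)
  next
    case False
    have "sgn (poly (pderiv P') c) = s" if "c < h w" for c
    proof -
      obtain c' where c': "c = h c'" using h(2) by (metis surjD)
      then have "c' < w" using that h(1) by (simp add: strict_mono_less)
      have "z < min w c' \<or> max w c' < z" if "z \<in> Z" for z
      proof -
        have "z \<noteq> w" "\<not> z < w" using that False w(2) by auto
        then show ?thesis using \<open>c' < w\<close> by auto
      qed
      then show ?thesis by (rule ds'[OF c'])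
    qed
    then show ?thesis using poly_eventually_sgn_pderiv_left[of "h w" P' s] s0 False by blast
  qed
  then obtain a where a: "a < h w" "\<And>z. z \<in> Z \<Longrightarrow> z < w \<Longrightarrow> h z \<le> a" "sgn (poly P' a) = - s" by blast
  have "poly P' a * poly P' b < 0"
  proof -
    have "sgn (poly P' a * poly P' b) = - (s * s)" using a(3) b(3) by (simp add: sgn_mult)
    moreover have "s * s > 0" using s0 not_real_square_gt_zero by blast
    ultimately show ?thesis by (metis neg_less_0_iff_less sgn_less)
  qed
  then obtain v where "a < v" "v < b" "poly P' v = 0" using poly_IVT[of a b P'] a(1) b(1) by auto
  moreover have "h z < v" if "z \<in> Z" "z < w" for z using a(2)[OF that] \<open>a < v\<close> by simp
  moreover have "v < h z" if "z \<in> Z" "w < z" for z using b(2)[OF that] \<open>v < b\<close> by simp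
  ultimately show ?thesis by blast
qed

text \<open>The inductive step of the Cohen--Hoermander method: the signs of \<open>P\<close> at the roots of the polynomials
  in \<open>I\<close>, among them \<open>pderiv P\<close>, determine the roots of \<open>P\<close> up to an order isomorphism.\<close>

lemma sign_diagram_extend:
  fixes P P' :: "real poly" and h :: "real \<Rightarrow> real"
  assumes h: "strict_mono h" "surj h" and "finite I"
    and dI: "(pderiv P, pderiv P') \<in> I" "pderiv P \<noteq> 0"
    and sg: "\<And>q q' y. (q, q') \<in> I \<Longrightarrow> sgn (poly q y) = sgn (poly q' (h y))"
    and rt: "\<And>q q' y. (q, q') \<in> I \<Longrightarrow> q \<noteq> 0 \<Longrightarrow> poly q y = 0 \<Longrightarrow> sgn (poly P y) = sgn (poly P' (h y))"
  shows "\<exists>h. strict_mono h \<and> surj h \<and>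
    (\<forall>(q, q')\<in>insert (P, P') I. \<forall>y. sgn (poly q y) = sgn (poly q' (h y)))"
proof -
  \<comment> \<open>On \<open>Z\<close> the old map \<open>h\<close> is retained; only the roots of
    \<open>P\<close> outside \<open>Z\<close> need new images.\<close>
  define Z where "Z = (\<Union>(q, q')\<in>{(q, q')\<in>I. q \<noteq> 0}. {y. poly q y = 0})"
  define W where "W = {y. poly P y = 0}"
  have ZI: "y \<in> Z" if "(q, q') \<in> I" "q \<noteq> 0" "poly q y = 0" for q q' y
    using that by (auto simp: Z_def)
  have "finite {(q, q')\<in>I. q \<noteq> 0}" using \<open>finite I\<close> by (rule rev_finite_subset) auto
  then have finZ: "finite Z" unfolding Z_def by (auto intro!: finite_UN_I poly_roots_finite)
  have "P \<noteq> 0" using dI(2) by auto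
  then have finW: "finite W" unfolding W_def by (rule poly_roots_finite)
  have zs: "sgn (poly P z) = sgn (poly P' (h z))" if "z \<in> Z" for z
    using that rt by (auto simp: Z_def)
  have dz: "y \<in> Z" if "poly (pderiv P) y = 0" for y using ZI dI that by blast
  have dz': "\<exists>z\<in>Z. y = h z" if "poly (pderiv P') y = 0" for y
  proof -
    obtain z where "y = h z" using h(2) by (metis surjD)
    then show ?thesis using sg[OF dI(1), of z] dz[of z] that by (auto simp: sgn_zero_iff)
  qed
  have "\<exists>v. poly P' v = 0 \<and> (\<forall>z\<in>Z. (z < w \<longrightarrow> h z < v) \<and> (w < z \<longrightarrow> v < h z))" if "w \<in> W - Z" for w
    using that dz zs sg[OF dI(1)] by (intro poly_root_transfer[OF h finZ, of P]) (auto simp: W_def)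
  then obtain v where v: "\<And>w. w \<in> W - Z \<Longrightarrow> poly P' (v w) = 0"
    "\<And>w z. w \<in> W - Z \<Longrightarrow> z \<in> Z \<Longrightarrow> z < w \<Longrightarrow> h z < v w"
    "\<And>w z. w \<in> W - Z \<Longrightarrow> z \<in> Z \<Longrightarrow> w < z \<Longrightarrow> v w < h z"
    by metis
  have rolle: "\<exists>c. a < c \<and> c < b \<and> poly (pderiv p) c = 0" 
    if "a < b" "poly p a = 0" "poly p b = 0" for a b and p :: "real poly"
    using poly_MVT[OF that(1), of p] that by auto
  define B where "B = Z \<union> W"
  have finB: "finite B" using finZ finW by (simp add: B_def)
  define G where "G y = (if y \<in> Z then h y else v y)" for y
  \<comment> \<open>Between two roots of \<open>P\<close> outside \<open>Z\<close>, Rolle's theorem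
    puts a critical point. It lies in \<open>Z\<close>, and its image separates the two new
    images.\<close>
  have "strict_mono_on B G"
  proof (rule strict_mono_onI)
    fix y z assume yz: "y \<in> B" "z \<in> B" "y < z"
    show "G y < G z"
    proof (cases "y \<in> Z \<or> z \<in> Z")
      case True
      then show ?thesis using yz v h(1) by (auto simp: G_def B_def strict_mono_less)
    next
      case False
      then obtain c where "y < c" "c < z" "poly (pderiv P) c = 0"
        using rolle[OF yz(3), of P] yz by (auto simp: B_def W_def)
      then have "v y < h c" "h c < v z" using v dz[of c] yz False by (auto simp: B_def)
      then show ?thesis using False by (simp add: G_def)
    qed
  qed
  then obtain h' where h': "strict_mono h'" "surj h'" and hG: "\<And>a. a \<in> B \<Longrightarrow> h' a = G a"
    using strict_mono_on_extend_surj[OF finB] by blast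
  have hZ: "h' z = h z" if "z \<in> Z" for z using that hG by (simp add: B_def G_def)
  have sg': "sgn (poly q y) = sgn (poly q' (h' y))" if I: "(q, q') \<in> I" for q q' y
  proof (cases "q = 0 \<or> y \<in> Z")
    case True
    \<comment> \<open>Since \<open>h\<close> is onto, \<open>q'\<close> vanishes everywhere.\<close>
    moreover have "q' = 0" if "q = 0"
    proof -
      have "poly q' x = 0" for x
        using sg[OF I] that h(2) by (metis poly_0 sgn_zero_iff surjD)
      then show ?thesis by (metis poly_all_0_iff_0)
    qed
    ultimately show ?thesis using sg[OF I, of y] hZ by auto
  next
    case False
    \<comment> \<open>A root of \<open>q'\<close> between \<open>h y\<close> and \<open>h' y\<close>
      would be \<open>h z = h' z\<close> for some \<open>z\<close> in \<open>Z\<close>; by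
      monotonicity of both maps, \<open>h y\<close> and \<open>h' y\<close> lie strictly on the same
      side of it.\<close>
    have "sgn (poly q' (h y)) = sgn (poly q' (h' y))"
    proof (rule poly_sgn_eq_on_interval)
      fix c assume c: "min (h y) (h' y) \<le> c" "c \<le> max (h y) (h' y)"
      obtain z where z: "c = h z" using h(2) by (metis surjD)
      show "poly q' c \<noteq> 0"
      proof
        assume "poly q' c = 0"
        then have "z \<in> Z" using sg[OF I, of z] z ZI[OF I] False by (auto simp: sgn_zero_iff)
        then have "c = h' z" "z \<noteq> y" using z hZ False by auto
        then consider "z < y" | "y < z" by linarith
        then show False
        proof cases
          case 1
          then have "h z < h y" "h' z < h' y" using h(1) h'(1) by (auto simp: strict_mono_less)
          then show False using c z \<open>c = h' z\<close> by simp
        next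
          case 2
          then have "h y < h z" "h' y < h' z" using h(1) h'(1) by (auto simp: strict_mono_less)
          then show False using c z \<open>c = h' z\<close> by simp
        qed
      qed
    qed
    then show ?thesis using sg[OF I, of y] by simp
  qed
  have PB: "sgn (poly P y) = sgn (poly P' (h' y))" if "y \<in> B" for y
    using that zs[of y] v(1)[of y] hG[of y] by (cases "y \<in> Z") (auto simp: B_def G_def W_def)
  \<comment> \<open>\<open>P'\<close> has no roots beyond those already matched: root transfer along
    \<open>inv h\<close> turns any further root \<open>u\<close> into a root \<open>w\<close> of
    \<open>P\<close> outside \<open>Z\<close>.\<close>
  have roots': "\<exists>y\<in>B. u = h' y" if u: "poly P' u = 0" for u
  proof -
    obtain y where y: "u = h y" using h(2) by (metis surjD)
    show ?thesis
    proof (cases "y \<in> Z")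
      case True then show ?thesis using y hZ by (intro bexI[of _ y]) (auto simp: B_def)
    next
      case False
      have inj: "inj h" using h(1) by (rule strict_mono_imp_inj_on)
      have "strict_mono (inv h)" 
        using h by (intro strict_monoI) (metis strict_mono_less surj_f_inv_f)
      moreover have "surj (inv h)" using inj by (rule inj_imp_surj_inv)
      moreover have "sgn (poly (pderiv P') z) = sgn (poly (pderiv P) (inv h z))" for z
        using sg[OF dI(1), of "inv h z"] h(2) by (simp add: surj_f_inv_f)
      moreover have "z \<in> h ` Z" if "poly (pderiv P') z = 0" for z using dz'[OF that] by blast
      moreover have "sgn (poly P' z) = sgn (poly P (inv h z))" if "z \<in> h ` Z" for z
        using that zs inj by (auto simp: inv_f_f)
      moreover have "u \<notin> h ` Z" using y False inj by (simp add: inj_image_mem_iff)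
      ultimately have "\<exists>w. poly P w = 0 \<and>
          (\<forall>z\<in>h ` Z. (z < u \<longrightarrow> inv h z < w) \<and> (u < z \<longrightarrow> w < inv h z))"
        using finZ u by (intro poly_root_transfer[where P = P' and h = "inv h"]) simp_all
      then obtain w where w: "poly P w = 0" "\<And>z. z \<in> Z \<Longrightarrow> h z < u \<Longrightarrow> z < w"
        "\<And>z. z \<in> Z \<Longrightarrow> u < h z \<Longrightarrow> w < z" using inj by (auto simp: inv_f_f)
      have "w \<notin> Z"
      proof
        assume "w \<in> Z"
        then have "\<not> h w < u" "\<not> u < h w" using w(2,3)[of w] by auto
        then have "h w = h y" using y by simp
        then show False using \<open>w \<in> Z\<close> False inj by (simp add: inj_eq)
      qed
      then have wW: "w \<in> W - Z" using w(1) by (simp add: W_def)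
      \<comment> \<open>Otherwise a critical point of \<open>P'\<close> separates the two. It has
        the form \<open>h z\<close> with \<open>z\<close> in \<open>Z\<close>, but \<open>u\<close>
        and \<open>v w\<close> lie on the same side of \<open>h z\<close> as prescribed by the order
        of \<open>w\<close> and \<open>z\<close>.\<close>
      have "u = v w"
      proof (rule ccontr)
        assume "u \<noteq> v w"
        then have "\<exists>c. (u < c \<and> c < v w \<or> v w < c \<and> c < u) \<and> poly (pderiv P') c = 0"
          using rolle[of u "v w" P'] rolle[of "v w" u P'] v(1)[OF wW] u by (metis linorder_neqE)
        then obtain z where z: "z \<in> Z" "u < h z \<and> h z < v w \<or> v w < h z \<and> h z < u"
          using dz' by blast
        then show False using w(2,3)[OF z(1)] v(2,3)[OF wW z(1)] by fastforce
      qed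
      then show ?thesis using wW hG[of w] by (intro bexI[of _ w]) (auto simp: B_def G_def)
    qed
  qed
  have noroot: "poly P c \<noteq> 0 \<and> poly (pderiv P) c \<noteq> 0" if "c \<notin> B" for c
    using that dz by (auto simp: B_def W_def)
  have noroot': "poly P' (h' c) \<noteq> 0 \<and> poly (pderiv P') (h' c) \<noteq> 0" if "c \<notin> B" for c
  proof -
    have "y = c" if "h' c = h' y" for y using that h'(1) by (metis strict_mono_eq)
    moreover have "\<exists>y\<in>B. h' c = h' y" if "poly (pderiv P') (h' c) = 0"
      using dz'[OF that] hZ unfolding B_def by (metis UnI1)
    ultimately show ?thesis using that roots'[of "h' c"] by metis
  qed
  \<comment> \<open>Off \<open>B\<close>, the sign follows from the nearest point of
    \<open>B\<close> on the left and from the sign of the derivative; left of all of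
    \<open>B\<close>, from the derivative alone.\<close>
  have "sgn (poly P y) = sgn (poly P' (h' y))" for y
  proof (cases "y \<in> B")
    case False
    show ?thesis
    proof (cases "\<exists>b\<in>B. b < y")
      case True
      define a where "a = Max {b\<in>B. b < y}"
      have "a \<in> {b\<in>B. b < y}" unfolding a_def using True finB by (intro Max_in) auto
      then have a: "a \<in> B" "a < y" by auto
      have out: "c \<notin> B" if "a < c" "c \<le> y" for c
      proof
        assume "c \<in> B"
        then have "c < y" using that False by (cases "c = y") auto
        then have "c \<le> a" unfolding a_def using \<open>c \<in> B\<close> finB by (intro Max_ge) auto
        then show False using that by simp
      qed
      have out': "poly P' c \<noteq> 0 \<and> poly (pderiv P') c \<noteq> 0" if "h' a < c" "c \<le> h' y" for c
      proof -
        obtain c' where "c = h' c'" using h'(2) by (metis surjD)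
        then show ?thesis using that noroot' out h'(1)
          by (simp add: strict_mono_less strict_mono_less_eq)
      qed
      have "sgn (poly P y) = (if poly P a = 0 then sgn (poly (pderiv P) y) else sgn (poly P a))"
        using a(2) out noroot by (intro poly_sgn_right_of) auto
      moreover have "sgn (poly P' (h' y)) = (if poly P' (h' a) = 0 then sgn (poly (pderiv P') (h' y)) 
          else sgn (poly P' (h' a)))"
        using a(2) out' h'(1) by (intro poly_sgn_right_of) (auto simp: strict_mono_less)
      ultimately show ?thesis using PB[OF a(1)] sg'[OF dI(1), of y] by (auto simp: sgn_zero_iff)
    next
      case none: False
      have out: "c \<notin> B" if "c \<le> y" for c using none False that by (cases "c = y") auto
      have out': "poly P' c \<noteq> 0 \<and> poly (pderiv P') c \<noteq> 0" if "c \<le> h' y" for c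
      proof -
        obtain c' where "c = h' c'" using h'(2) by (metis surjD)
        then show ?thesis using that noroot' out h'(1) by (simp add: strict_mono_less_eq)
      qed
      show ?thesis
        using poly_sgn_leftmost[of y P] poly_sgn_leftmost[of "h' y" P'] out noroot out' sg'[OF dI(1), of y]
        by simp
    qed
  qed (rule PB)
  then show ?thesis using h' sg' by (intro exI[of _ h']) auto
qed

section \<open>Sign diagrams with polynomial parameters\<close>

lemmas real_polynomial_function_const = real_polynomial_function.intros(2)
lemmas real_polynomial_function_add = real_polynomial_function.intros(3)
lemmas real_polynomial_function_mult = real_polynomial_function.intros(4)

text \<open>The index \<open>d\<close> is a formal degree: the leading coefficient may vanish at some parameters.\<close>

definition poly_family :: "nat \<Rightarrow> ('a::real_normed_vector \<Rightarrow> real poly) \<Rightarrow> bool" where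
  "poly_family d p \<longleftrightarrow> (\<forall>x. degree (p x) \<le> d) \<and> (\<forall>i. real_polynomial_function (\<lambda>x. coeff (p x) i))"

section \<open>Closure properties of polynomial families and pseudo-division\<close>

lemma poly_family_mono: "poly_family d p \<Longrightarrow> d \<le> e \<Longrightarrow> poly_family e p"
  unfolding poly_family_def by (meson le_trans)

lemma poly_familyI:
  "(\<And>x. degree (p x) \<le> d) \<Longrightarrow> (\<And>i. real_polynomial_function (\<lambda>x. coeff (p x) i)) \<Longrightarrow> poly_family d p"
  by (simp add: poly_family_def)

lemma poly_familyD:
  assumes "poly_family d p"
  shows "degree (p x) \<le> d" "real_polynomial_function (\<lambda>x. coeff (p x) i)"
  using assms by (simp_all add: poly_family_def)

lemma poly_family_monom:
  assumes "real_polynomial_function f"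
  shows "poly_family d (\<lambda>x. monom (f x) d)"
proof (rule poly_familyI)
  show "real_polynomial_function (\<lambda>x. coeff (monom (f x) d) i)" for i
    using assms by (cases "i = d") (simp_all add: real_polynomial_function_const)
qed (rule degree_monom_le)

lemma poly_family_add:
  assumes "poly_family d p" "poly_family d q"
  shows "poly_family d (\<lambda>x. p x + q x)"
  using assms by (intro poly_familyI)
    (simp_all add: degree_add_le poly_familyD real_polynomial_function_add)

lemma poly_family_diff:
  assumes "poly_family d p" "poly_family d q"
  shows "poly_family d (\<lambda>x. p x - q x)"
  using assms by (intro poly_familyI)
    (simp_all add: degree_diff_le poly_familyD real_polynomial_function_diff)

lemma poly_family_mult:
  assumes "poly_family d p" "poly_family e q"
  shows "poly_family (d + e) (\<lambda>x. p x * q x)"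
proof (rule poly_familyI)
  show "degree (p x * q x) \<le> d + e" for x
    using degree_mult_le[of "p x"
      "q x"] poly_familyD(1)[OF assms(1), of x] poly_familyD(1)[OF assms(2), of x]
    by linarith
  show "real_polynomial_function (\<lambda>x. coeff (p x * q x) i)" for i
    unfolding coeff_mult
    by (intro real_polynomial_function_sum real_polynomial_function_mult poly_familyD(2)[OF assms(1)]
        poly_familyD(2)[OF assms(2)] finite_atMost)
qed

lemma poly_family_smult:
  assumes "real_polynomial_function f" "poly_family d p"
  shows "poly_family d (\<lambda>x. smult (f x) (p x))"
proof (rule poly_familyI)
  show "degree (smult (f x) (p x)) \<le> d" for x
    using degree_smult_le poly_familyD(1)[OF assms(2)] by (rule le_trans)
  show "real_polynomial_function (\<lambda>x. coeff (smult (f x) (p x)) i)" for i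
    using assms by (simp add: real_polynomial_function_mult poly_familyD(2))
qed

lemma poly_family_pderiv:
  assumes "poly_family d p"
  shows "poly_family (d - 1) (\<lambda>x. pderiv (p x))"
proof (rule poly_familyI)
  show "degree (pderiv (p x)) \<le> d - 1" for x
    using poly_familyD(1)[OF assms, of x] by (simp add: degree_pderiv diff_le_mono)
  show "real_polynomial_function (\<lambda>x. coeff (pderiv (p x)) i)" for i
    unfolding coeff_pderiv
    by (intro real_polynomial_function_mult real_polynomial_function_const poly_familyD(2)[OF assms])
qed

lemma poly_family_lower:
  assumes "poly_family d p" "\<And>x. coeff (p x) d = 0"
  shows "poly_family (d - 1) p"
proof -
  have "degree (p x) \<le> d - 1" for x
  proof (rule degree_le, intro allI impI)
    fix i assume "d - 1 < i"
    then have "d \<le> i" by simp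
    then show "coeff (p x) i = 0"
      using assms unfolding poly_family_def by (metis coeff_eq_0 le_eq_less_or_eq le_less_trans)
  qed
  then show ?thesis using assms(1) by (simp add: poly_family_def)
qed

text \<open>At parameters where the formal leading coefficient vanishes, the truncated family takes
  the same values as \<open>p\<close>; for \<open>0 < d\<close> its formal degree is
  smaller.\<close>

lemma poly_family_truncate:
  assumes "poly_family d p"
  shows "poly_family (d - 1) (\<lambda>x. p x - monom (coeff (p x) d) d)"
proof (rule poly_family_lower)
  show "poly_family d (\<lambda>x. p x - monom (coeff (p x) d) d)"
    using assms by (intro poly_family_diff poly_family_monom poly_familyD(2))
qed simp

text \<open>Multiplying by the square of the leading coefficient, rather than by the leading coefficient
  itself, keeps the signs at the roots of the divisor.\<close>

lemma poly_family_pseudo_remainder: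
  assumes "poly_family e q" "0 < e" "poly_family d p"
  shows "\<exists>r. poly_family (e - 1) r \<and>
    (\<forall>x y. coeff (q x) e \<noteq> 0 \<longrightarrow> poly (q x) y = 0 \<longrightarrow> sgn (poly (r x) y) = sgn (poly (p x) y))"
  using assms(3)
proof (induction d arbitrary: p)
  case 0
  then show ?case using poly_family_mono by blast
next
  case (Suc d)
  show ?case
  proof (cases "Suc d < e")
    case True
    then have "poly_family (e - 1) p" using poly_family_mono[OF Suc.prems] by simp
    then show ?thesis by blast
  next
    case False
    define b where "b = (\<lambda>x. coeff (q x) e)"
    define a where "a = (\<lambda>x. coeff (p x) (Suc d))"
    have ab: "real_polynomial_function a" "real_polynomial_function b"
      using assms(1) Suc.prems by (simp_all add: poly_familyD(2) a_def b_def)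
    \<comment> \<open>One division step: both coefficients of degree \<open>Suc d\<close> equal
      \<open>b x * b x * a x\<close> and cancel, and at a root of \<open>q x\<close> only the
      multiple of \<open>p x\<close> by a square remains.\<close>
    define p' where "p' = (\<lambda>x. smult (b x * b x) (p x) - smult (b x * a x) (monom 1 (Suc d - e) * q x))"
    have "poly_family (Suc d - e + e) (\<lambda>x. monom 1 (Suc d - e) * q x)"
      using assms(1) by (intro poly_family_mult poly_family_monom real_polynomial_function_const)
    then have "poly_family (Suc d) p'"
      using ab Suc.prems False unfolding p'_def
      by (intro poly_family_diff poly_family_smult real_polynomial_function_mult) simp_all
    moreover have "coeff (p' x) (Suc d) = 0" for x
      using False by (simp add: p'_def a_def b_def coeff_monom_mult not_less)
    ultimately have "poly_family d p'" using poly_family_lower[of "Suc d" p'] by simp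
    then obtain r where r: "poly_family (e - 1) r"
      "\<And>x y. coeff (q x) e \<noteq> 0 \<Longrightarrow> poly (q x) y = 0 \<Longrightarrow> sgn (poly (r x) y) = sgn (poly (p' x) y)"
      using Suc.IH by blast
    have "sgn (poly (p' x) y) = sgn (poly (p x) y)" if "coeff (q x) e \<noteq> 0" "poly (q x) y = 0" for x y
    proof -
      have "sgn (b x * b x) = 1" using that(1)
        by (auto simp: b_def sgn_1_pos zero_less_mult_iff linorder_neq_iff)
      then have "sgn (b x * b x * poly (p x) y) = sgn (poly (p x) y)" by (simp only: sgn_mult)
      then show ?thesis using that(2) by (simp add: p'_def)
    qed
    then show ?thesis using r by auto
  qed
qed

section \<open>Determination of sign diagrams by finitely many signs\<close>

text \<open>An order isomorphism of the line takes the place of an explicit list of roots with the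
  sign vectors on and between them.\<close>

definition same_sign_diagram :: "('a \<Rightarrow> real poly) set \<Rightarrow> 'a \<Rightarrow> 'a \<Rightarrow> bool" where
  "same_sign_diagram \<Phi> x x' \<longleftrightarrow>
    (\<exists>h. strict_mono h \<and> surj h \<and> (\<forall>p\<in>\<Phi>. \<forall>y. sgn (poly (p x) y) = sgn (poly (p x') (h y))))"

text \<open>At a root of a divisor \<open>q\<close>, the sign of \<open>P\<close> is that of its
  remainder in \<open>R\<close>, and \<open>h\<close> already matches the signs of the remainders.
  So the values needed for adding \<open>P\<close> agree, after which \<open>R\<close> is
  dropped.\<close>

lemma same_sign_diagram_extend:
  fixes P :: "'a \<Rightarrow> real poly"
  assumes same: "same_sign_diagram (insert (\<lambda>x. pderiv (P x)) \<Psi> \<union> R) x x'" and "finite \<Psi>"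
    and "pderiv (P x) \<noteq> 0"
    and rem: "\<And>q. q \<in> insert (\<lambda>x. pderiv (P x)) \<Psi> \<Longrightarrow> q x \<noteq> 0 \<Longrightarrow>
       (\<exists>y. poly (q x) y = 0) \<Longrightarrow> \<exists>r\<in>R. \<forall>z\<in>{x, x'}. \<forall>y. poly (q z) y = 0 \<longrightarrow>
         sgn (poly (r z) y) = sgn (poly (P z) y)"
  shows "same_sign_diagram (insert P \<Psi>) x x'"
proof -
  obtain h where h: "strict_mono h" "surj h"
    and hs: "\<And>p y. p \<in> insert (\<lambda>x. pderiv (P x)) \<Psi> \<union> R \<Longrightarrow> sgn (poly (p x) y) = sgn (poly (p x') (h y))"
    using same unfolding same_sign_diagram_def by (metis (no_types))
  define I where "I = (\<lambda>q. (q x, q x')) ` insert (\<lambda>x. pderiv (P x)) \<Psi>"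
  have "\<exists>h. strict_mono h \<and> surj h \<and>
      (\<forall>(q, q')\<in>insert (P x, P x') I. \<forall>y. sgn (poly q y) = sgn (poly q' (h y)))"
  proof (rule sign_diagram_extend[OF h])
    show "finite I" using assms(2) by (simp add: I_def)
    show "(pderiv (P x), pderiv (P x')) \<in> I" by (auto simp: I_def)
    show "sgn (poly q y) = sgn (poly q' (h y))" if "(q, q') \<in> I" for q q' y
      using that hs by (auto simp: I_def)
    show "sgn (poly (P x) y) = sgn (poly (P x') (h y))"
      if qI: "(q, q') \<in> I" "q \<noteq> 0" "poly q y = 0" for q q' y
    proof -
      from qI(1) obtain f where "f \<in> insert (\<lambda>x. pderiv (P x)) \<Psi>" and "(q, q') = (f x, f x')"
        unfolding I_def by (rule imageE)
      then have f: "f \<in> insert (\<lambda>x. pderiv (P x)) \<Psi>" "q = f x" "q' = f x'" by simp_all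
      then obtain r where r: "r \<in> R"
        "\<And>z y. z \<in> {x, x'} \<Longrightarrow> poly (f z) y = 0 \<Longrightarrow> sgn (poly (r z) y) = sgn (poly (P z) y)"
        using rem[of f] qI(2,3) by blast
      \<comment> \<open>Roots go to roots, so the property of the remainder applies at
        \<open>x'\<close> as well.\<close>
      have "poly (f x') (h y) = 0" using hs[of f y] f qI(3) by (auto simp: sgn_zero_iff)
      then show ?thesis using r(2)[of x y] r(2)[of x' "h y"] hs[of r y] r(1) f qI(3) by auto
    qed
  qed (use assms(3) in auto)
  then show ?thesis unfolding same_sign_diagram_def I_def by (auto simp: Ball_def)
qed

text \<open>The termination measure is the multiset of formal degrees: one polynomial may be traded
  for any finite number of polynomials of smaller degree.\<close>

lemma mult_less_than_replace:
  assumes "x \<in># M" "\<And>k. k \<in># K \<Longrightarrow> k < f x"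
  shows "(image_mset f (M - {#x#}) + K, image_mset f M) \<in> mult less_than"
proof -
  have "image_mset f M = image_mset f (M - {#x#}) + {#f x#}"
    using assms(1) by (metis image_mset_add_mset insert_DiffM add_mset_add_single)
  then show ?thesis using assms(2) one_step_implies_mult[of "{#f x#}" K less_than] by simp
qed

text \<open>Induction on the multiset of formal degrees. Where a leading coefficient of positive
  degree vanishes, that polynomial is truncated. Elsewhere a polynomial \<open>P\<close> of largest
  degree is replaced by its derivative and by its remainders modulo the derivative and the other
  polynomials, from which its signs are recovered.\<close>

theorem sign_diagram_determined:
  fixes \<Phi> :: "(nat \<times> ('a::real_normed_vector \<Rightarrow> real poly)) multiset"
  assumes "\<forall>(d, p)\<in>#\<Phi>. poly_family d p"
  shows "\<exists>F. finite F \<and> (\<forall>f\<in>F. real_polynomial_function f) \<and>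
    (\<forall>x x'. (\<forall>f\<in>F. sgn (f x) = sgn (f x')) \<longrightarrow> same_sign_diagram (snd ` set_mset \<Phi>) x x')"
  using assms
proof (induction \<Phi> rule: wf_induct_rule[OF wf_inv_image[OF wf_mult[OF wf_less_than], of "image_mset fst"]])
  case (1 \<Phi>)
  have fam: "poly_family (fst k) (snd k)" if "k \<in># \<Phi>" for k using 1(2) that by auto
  define lc where "lc k x = coeff (snd k x) (fst k)" for k :: "nat \<times> ('a \<Rightarrow> real poly)" and x
  have lc: "real_polynomial_function (lc k)" if "k \<in># \<Phi>" for k
    using poly_familyD(2)[OF fam[OF that], of "fst k"] by (simp add: lc_def [abs_def])
  show ?case
  proof (cases "\<forall>k\<in>#\<Phi>. fst k = 0")
    case True
    have "poly (snd k x) y = lc k x" if "k \<in># \<Phi>" for k x y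
    proof -
      have "degree (snd k x) = 0" using fam[OF that] True that by (auto simp: poly_family_def)
      then show ?thesis using True that
        by (metis lc_def degree_eq_zeroE coeff_pCons_0 poly_pCons mult_zero_right add.right_neutral poly_0)
    qed
    then have "same_sign_diagram (snd ` set_mset \<Phi>) x x'"
      if "\<forall>f\<in>lc ` set_mset \<Phi>. sgn (f x) = sgn (f x')" for x x'
      unfolding same_sign_diagram_def using that
      by (intro exI[of _ id]) (force simp: strict_mono_def)
    then show ?thesis using lc by (intro exI[of _ "lc ` set_mset \<Phi>"]) auto
  next
    case False
    \<comment> \<open>Maximality of \<open>d\<close> makes every remainder smaller than
      \<open>P\<close> in formal degree, whichever divisor is used.\<close>
    define d where "d = Max (fst ` set_mset \<Phi>)"
    have "d \<in> fst ` set_mset \<Phi>" unfolding d_def using False by (intro Max_in) auto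
    then obtain P where P: "(d, P) \<in># \<Phi>" by auto
    have le_d: "fst k \<le> d" if "k \<in># \<Phi>" for k unfolding d_def using that by (intro Max_ge) auto
    have "0 < d" using False le_d by fastforce
    define \<Psi> where "\<Psi> = \<Phi> - {#(d, P)#}"
    have \<Psi>: "\<Phi> = add_mset (d, P) \<Psi>" using P by (simp add: \<Psi>_def)
    define \<Psi>' where "\<Psi>' = add_mset (d - 1, \<lambda>x. pderiv (P x)) \<Psi>"
    have fam': "poly_family (fst k) (snd k)" if "k \<in># \<Psi>'" for k
      using that fam poly_family_pderiv[of d P] P by (auto simp: \<Psi>'_def \<Psi>)
    have "\<exists>r. poly_family (fst k - 1) r \<and> (\<forall>x y. lc k x \<noteq> 0 \<longrightarrow> poly (snd k x) y = 0 \<longrightarrow>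
        sgn (poly (r x) y) = sgn (poly (P x) y))" if "k \<in># \<Psi>'" "0 < fst k" for k
      unfolding lc_def using poly_family_pseudo_remainder[OF fam'[OF that(1)] that(2)] fam[OF P] by simp
    then obtain r where r: "\<And>k. k \<in># \<Psi>' \<Longrightarrow> 0 < fst k \<Longrightarrow> poly_family (fst k - 1) (r k)"
      "\<And>k x y. k \<in># \<Psi>' \<Longrightarrow> 0 < fst k \<Longrightarrow> lc k x \<noteq> 0 \<Longrightarrow> poly (snd k x) y = 0 \<Longrightarrow>
        sgn (poly (r k x) y) = sgn (poly (P x) y)"
      by metis
    \<comment> \<open>A divisor of formal degree 0 is constant at each parameter; it has a root only
      if it vanishes identically there, so no remainder is formed.\<close>
    define R where "R = image_mset (\<lambda>k. (fst k - 1, r k)) (filter_mset (\<lambda>k. 0 < fst k) \<Psi>')"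
    \<comment> \<open>This family describes \<open>\<Phi>\<close> at the parameters where the
      leading coefficient of \<open>k\<close> vanishes.\<close>
    define T where "T k = add_mset (fst k - 1, \<lambda>x. snd k x - monom (lc k x) (fst k)) (\<Phi> - {#k#})"
      for k :: "nat \<times> ('a \<Rightarrow> real poly)"
    have "(image_mset fst (\<Psi>' + R), image_mset fst \<Phi>) \<in> mult less_than"
    proof -
      have "image_mset fst (\<Psi>' + R) = image_mset fst (\<Phi> - {#(d, P)#}) + add_mset (d - 1) (image_mset fst R)"
        by (simp add: \<Psi>'_def \<Psi>_def)
      moreover have "k < d" if "k \<in># add_mset (d - 1) (image_mset fst R)" for k
      proof -
        have "fst j - 1 < d" if "j \<in># \<Psi>'" "0 < fst j" for j
          using that \<open>0 < d\<close> le_d[of j] by (auto simp: \<Psi>'_def \<Psi>)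
        then show ?thesis using that \<open>0 < d\<close> by (auto simp: R_def)
      qed
      ultimately show ?thesis
        using mult_less_than_replace[OF P, of "add_mset (d - 1) (image_mset fst R)" fst] by simp
    qed
    moreover have "\<forall>(d, p)\<in>#\<Psi>' + R. poly_family d p"
      using fam' r(1) by (auto simp: R_def)
    ultimately obtain F0 where F0: "finite F0" "\<forall>f\<in>F0. real_polynomial_function f"
      "\<And>x x'. (\<forall>f\<in>F0. sgn (f x) = sgn (f x')) \<Longrightarrow> same_sign_diagram (snd ` set_mset (\<Psi>' + R)) x x'"
      using 1(1)[of "\<Psi>' + R"] by (auto simp: in_inv_image)
    have "\<exists>F. finite F \<and> (\<forall>f\<in>F. real_polynomial_function f) \<and>
      (\<forall>x x'. (\<forall>f\<in>F. sgn (f x) = sgn (f x')) \<longrightarrow> same_sign_diagram (snd ` set_mset (T k)) x x')"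
      if k: "k \<in># \<Phi>" "0 < fst k" for k
    proof -
      have "(image_mset fst (T k), image_mset fst \<Phi>) \<in> mult less_than"
        using mult_less_than_replace[OF k(1), of "{#fst k - 1#}" fst] k(2) by (simp add: T_def)
      moreover have "\<forall>(d, p)\<in>#T k. poly_family d p"
        using fam poly_family_truncate[OF fam[OF k(1)]] by (auto simp: T_def lc_def dest: in_diffD)
      ultimately show ?thesis using 1(1)[of "T k"] by (simp add: in_inv_image)
    qed
    then obtain F1 where F1: "\<And>k. k \<in># \<Phi> \<Longrightarrow> 0 < fst k \<Longrightarrow> finite (F1 k)"
      "\<And>k f. k \<in># \<Phi> \<Longrightarrow> 0 < fst k \<Longrightarrow> f \<in> F1 k \<Longrightarrow> real_polynomial_function f"
      "\<And>k x x'. k \<in># \<Phi> \<Longrightarrow> 0 < fst k \<Longrightarrow> (\<forall>f\<in>F1 k. sgn (f x) = sgn (f x')) \<Longrightarrow>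
        same_sign_diagram (snd ` set_mset (T k)) x x'"
      by metis
    \<comment> \<open>\<open>F0\<close> and \<open>F1\<close> come from the recursive calls. The
      signs of the leading coefficients ensure that the same call applies at \<open>x\<close> and at
      \<open>x'\<close>.\<close>
    define F where "F = F0 \<union> (\<Union>k\<in>{k\<in>set_mset \<Phi>. 0 < fst k}. F1 k) \<union> lc ` set_mset \<Phi>"
    have "finite F" using F0(1) F1(1) by (auto simp: F_def)
    moreover have "\<forall>f\<in>F. real_polynomial_function f" using F0(2) F1(2) lc by (auto simp: F_def)
    moreover have "same_sign_diagram (snd ` set_mset \<Phi>) x x'"
      if F: "\<forall>f\<in>F. sgn (f x) = sgn (f x')" for x x'
    proof (cases "\<exists>k\<in>#\<Phi>. 0 < fst k \<and> lc k x = 0")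
      case True
      then obtain k where k: "k \<in># \<Phi>" "0 < fst k" "lc k x = 0" by auto
      then have "sgn (lc k x) = sgn (lc k x')" using F unfolding F_def by blast
      then have k': "lc k x' = 0" using k(3) by (simp add: sgn_zero_iff)
      have "\<forall>f\<in>F1 k. sgn (f x) = sgn (f x')" using F k by (auto simp: F_def)
      then have "same_sign_diagram (snd ` set_mset (T k)) x x'" using F1(3) k by blast
      moreover have "\<exists>p\<in>snd ` set_mset (T k). p x = q x \<and> p x' = q x'" if q: "q \<in> snd ` set_mset \<Phi>" for q
      proof (cases "q \<in> snd ` set_mset (\<Phi> - {#k#})")
        case True
        then show ?thesis by (auto simp: T_def)
      next
        case False
        then have "q = snd k" using q k(1)
          by (metis (no_types, lifting) image_iff insert_DiffM insert_noteq_member)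
        then show ?thesis using k(3) k' by (auto simp: T_def)
      qed
      ultimately show ?thesis unfolding same_sign_diagram_def by metis
    next
      case nz: False
      have nz': "\<not> (\<exists>k\<in>#\<Phi>. 0 < fst k \<and> lc k x' = 0)"
      proof -
        have "sgn (lc k x) = sgn (lc k x')" if "k \<in># \<Phi>" for k using F that unfolding F_def by blast
        then show ?thesis using nz by (simp add: sgn_zero_iff) (metis sgn_zero_iff)
      qed
      have lcP: "lc (d - 1, \<lambda>x. pderiv (P x)) z = real d * lc (d, P) z" for z
        using \<open>0 < d\<close> by (simp add: lc_def coeff_pderiv)
      have nzP: "lc k z \<noteq> 0" if "z \<in> {x, x'}" "k \<in># \<Psi>'" "0 < fst k" for k z
        using that nz nz' P \<open>0 < d\<close> lcP by (auto simp: \<Psi>'_def \<Psi>)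
      have "same_sign_diagram (insert P (snd ` set_mset \<Psi>)) x x'"
      proof (rule same_sign_diagram_extend[where R = "snd ` set_mset R"])
        show "same_sign_diagram (insert (\<lambda>x. pderiv (P x)) (snd ` set_mset \<Psi>) \<union> snd ` set_mset R) x x'"
          using F0(3)[of x x'] F by (auto simp: F_def \<Psi>'_def image_Un)
        have "lc (d - 1, \<lambda>x. pderiv (P x)) x \<noteq> 0" using lcP nz P \<open>0 < d\<close> by auto
        then show "pderiv (P x) \<noteq> 0" by (auto simp: lc_def)
        fix q assume q: "q \<in> insert (\<lambda>x. pderiv (P x)) (snd ` set_mset \<Psi>)" "q x \<noteq> 0"
          "\<exists>y. poly (q x) y = 0"
        then have "q \<in> snd ` set_mset \<Psi>'" by (auto simp: \<Psi>'_def)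
        then obtain e where k: "(e, q) \<in># \<Psi>'" by auto
        have "0 < e"
        proof (rule ccontr)
          assume "\<not> 0 < e"
          then have "degree (q x) = 0" using fam'[OF k] by (auto simp: poly_family_def)
          then show False using q(2,3) by (auto elim!: degree_eq_zeroE)
        qed
        then have "r (e, q) \<in> snd ` set_mset R" using k by (force simp: R_def)
        moreover have "\<forall>z\<in>{x, x'}. \<forall>y. poly (q z) y = 0 \<longrightarrow> sgn (poly (r (e, q) z) y) = sgn (poly (P z) y)"
          using r(2)[OF k] nzP[OF _ k] \<open>0 < e\<close> by simp
        ultimately show "\<exists>r\<in>snd ` set_mset R. \<forall>z\<in>{x, x'}. \<forall>y. poly (q z) y = 0 \<longrightarrow>
          sgn (poly (r z) y) = sgn (poly (P z) y)"
          by blast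
      qed simp
      then show ?thesis by (simp add: \<Psi>)
    qed
    ultimately show ?thesis by blast
  qed
qed

section \<open>Projections of semialgebraic sets\<close>

text \<open>Induction over the formation of polynomial functions. It isolates the variable along
  \<open>b\<close> and leaves the base point as a parameter.\<close>

lemma real_polynomial_function_line:
  fixes f :: "'a::real_normed_vector \<Rightarrow> real"
  assumes "real_polynomial_function f"
  shows "\<exists>d p. poly_family d p \<and> (\<forall>x y. f (x + y *\<^sub>R b) = poly (p x) y)"
  using assms
proof induction
  case (linear f)
  interpret f: bounded_linear f by fact
  have "poly_family 1 (\<lambda>x. monom (f x) 0 + monom (f b) 1)"
    using poly_family_mono[OF poly_family_monom[OF real_polynomial_function.intros(1)[OF linear]], of 0 1]
    by (intro poly_family_add poly_family_monom real_polynomial_function_const) simp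
  moreover have "f (x + y *\<^sub>R b) = poly (monom (f x) 0 + monom (f b) 1) y" for x y
    by (simp add: f.add f.scaleR poly_monom)
  ultimately show ?case by blast
next
  case (const c)
  have "poly_family 0 (\<lambda>x::'a. monom c 0)"
    by (intro poly_family_monom real_polynomial_function_const)
  moreover have "c = poly (monom c 0) y" for y by (simp add: poly_monom)
  ultimately show ?case by blast
next
  case (add f g)
  then obtain d p e q where "poly_family d p" "\<And>x y. f (x + y *\<^sub>R b) = poly (p x) y"
    "poly_family e q" "\<And>x y. g (x + y *\<^sub>R b) = poly (q x) y"
    by blast
  moreover from this have "poly_family (max d e) (\<lambda>x. p x + q x)"
    by (intro poly_family_add) (auto elim: poly_family_mono)
  ultimately show ?case by (intro exI[of _ "max d e"] exI[of _ "\<lambda>x. p x + q x"]) auto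
next
  case (mult f g)
  then obtain d p e q where "poly_family d p" "\<And>x y. f (x + y *\<^sub>R b) = poly (p x) y"
    "poly_family e q" "\<And>x y. g (x + y *\<^sub>R b) = poly (q x) y"
    by blast
  moreover from this have "poly_family (d + e) (\<lambda>x. p x * q x)"
    by (intro poly_family_mult)
  ultimately show ?case by (intro exI[of _ "d + e"] exI[of _ "\<lambda>x. p x * q x"]) auto
qed

text \<open>Equivalent to being a finite Boolean combination of sets \<open>{x. f x > 0}\<close> with \<open>f\<close> polynomial.\<close>

definition semialgebraic :: "'a::real_normed_vector set \<Rightarrow> bool" where
  "semialgebraic S \<longleftrightarrow> (\<exists>F. finite F \<and> (\<forall>f\<in>F. real_polynomial_function f) \<and>
    (\<forall>x x'. (\<forall>f\<in>F. sgn (f x) = sgn (f x')) \<longrightarrow> x \<in> S \<longrightarrow> x' \<in> S))"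

text \<open>The Tarski--Seidenberg theorem, with the quantified variable running along the direction \<open>b\<close>.\<close>

theorem semialgebraic_project_line:
  fixes S :: "'a::real_normed_vector set"
  assumes "semialgebraic S"
  shows "semialgebraic {x. \<exists>y. x + y *\<^sub>R b \<in> S}"
proof -
  obtain F where F: "finite F" "\<And>f. f \<in> F \<Longrightarrow> real_polynomial_function f"
    "\<And>x x'. (\<forall>f\<in>F. sgn (f x) = sgn (f x')) \<Longrightarrow> x \<in> S \<Longrightarrow> x' \<in> S"
    using assms unfolding semialgebraic_def by metis
  obtain d p where dp: "\<And>f. f \<in> F \<Longrightarrow> poly_family (d f) (p f)"
    "\<And>f x y. f \<in> F \<Longrightarrow> f (x + y *\<^sub>R b) = poly (p f x) y"
    using real_polynomial_function_line[OF F(2), of _ b] by metis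
  define \<Phi> where "\<Phi> = image_mset (\<lambda>f. (d f, p f)) (mset_set F)"
  have "\<forall>(d, p)\<in>#\<Phi>. poly_family d p" using dp(1) F(1) by (auto simp: \<Phi>_def)
  then obtain F' where F': "finite F'" "\<forall>f\<in>F'. real_polynomial_function f"
    "\<And>x x'. (\<forall>f\<in>F'. sgn (f x) = sgn (f x')) \<Longrightarrow> same_sign_diagram (snd ` set_mset \<Phi>) x x'"
    using sign_diagram_determined[of \<Phi>] by metis
  have "\<exists>y. x' + y *\<^sub>R b \<in> S" if x: "\<forall>f\<in>F'. sgn (f x) = sgn (f x')" "x + y *\<^sub>R b \<in> S" for x x' y
  proof -
    \<comment> \<open>The order isomorphism carries a witness \<open>y\<close> for \<open>x\<close>
      to the witness \<open>h y\<close> for \<open>x'\<close>.\<close>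
    obtain h where "\<forall>q\<in>snd ` set_mset \<Phi>. \<forall>y. sgn (poly (q x) y) = sgn (poly (q x') (h y))"
      using F'(3)[OF x(1)] unfolding same_sign_diagram_def by blast
    then have "\<forall>f\<in>F. sgn (f (x + y *\<^sub>R b)) = sgn (f (x' + h y *\<^sub>R b))"
      using dp(2) F(1) by (auto simp: \<Phi>_def)
    then show ?thesis using F(3) x(2) by blast
  qed
  then show ?thesis unfolding semialgebraic_def using F'(1,2)
    by (intro exI[of _ F'] conjI allI impI) blast+
qed

text \<open>A quantifier over a vector is eliminated one spanning direction at a time.\<close>

lemma semialgebraic_project_span:
  assumes "finite B" "semialgebraic S"
  shows "semialgebraic {x. \<exists>v\<in>span B. x + v \<in> S}"
  using assms
proof (induction B rule: finite_induct)
  case (insert b B)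
  have "(\<exists>v\<in>span (insert b B). x + v \<in> S) \<longleftrightarrow> (\<exists>y. \<exists>v\<in>span B. x + y *\<^sub>R b + v \<in> S)" for x
  proof
    assume "\<exists>v\<in>span (insert b B). x + v \<in> S"
    then obtain v y where "v - y *\<^sub>R b \<in> span B" "x + v \<in> S" by (auto simp: span_insert)
    then show "\<exists>y. \<exists>v\<in>span B. x + y *\<^sub>R b + v \<in> S"
      by (intro exI[of _ y] bexI[of _ "v - y *\<^sub>R b"]) auto
  next
    assume "\<exists>y. \<exists>v\<in>span B. x + y *\<^sub>R b + v \<in> S"
    then obtain y v where "v \<in> span B" "x + y *\<^sub>R b + v \<in> S" by blast
    then show "\<exists>v\<in>span (insert b B). x + v \<in> S"
      by (intro bexI[of _ "y *\<^sub>R b + v"]) (auto simp: span_insert add.assoc intro!: exI[of _ y])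
  qed
  then show ?case using semialgebraic_project_line[OF insert.IH[OF insert.prems], of b] by simp
qed simp

section \<open>Polynomials in two variables with the squared radius as parameter\<close>

text \<open>Here \<open>t\<close> stands for a level of one function and \<open>q\<close> for a
  bound on the other; \<open>N\<close> bounds each exponent separately.\<close>

definition bipoly :: "nat \<Rightarrow> (nat \<Rightarrow> nat \<Rightarrow> real) \<Rightarrow> real \<Rightarrow> real \<Rightarrow> real" where
  "bipoly N c t q = (\<Sum>a\<le>N. \<Sum>b\<le>N. c a b * t ^ a * q ^ b)"

lemma poly_eq_sum_atMost: "degree (p :: real poly) \<le> n \<Longrightarrow> poly p x = (\<Sum>i\<le>n. coeff p i * x ^ i)"
  using arg_cong[OF poly_as_sum_of_monoms', of p n "\<lambda>p. poly p x"] by (simp add: poly_sum poly_monom)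

text \<open>The function is expanded in \<open>q\<close>, then each coefficient in \<open>t\<close>.
  Allowing every \<open>M\<close> above \<open>N\<close> makes a common degree bound available for
  finitely many functions.\<close>

lemma real_polynomial_function_bipoly:
  fixes f :: "'a::real_normed_vector \<times> real \<times> real \<times> real \<Rightarrow> real"
  assumes "real_polynomial_function f"
  shows "\<exists>N c. \<forall>M\<ge>N. \<forall>s t q. f (0, s, t, q) = bipoly M (c s) t q"
proof -
  obtain d p where p: "poly_family d p" "\<And>x y. f (x + y *\<^sub>R (0, 0, 0, 1)) = poly (p x) y"
    using real_polynomial_function_line[OF assms, of "(0, 0, 0, 1)"] by blast
  obtain e r where r: "\<And>b. poly_family (e b) (r b)"
    "\<And>b x y. coeff (p (x + y *\<^sub>R (0, 0, 1, 0))) b = poly (r b x) y"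
    using real_polynomial_function_line[where b = "(0, 0, 1, 0)", OF poly_familyD(2)[OF p(1)]] by metis
  define c where "c s a b = (if b \<le> d then coeff (r b (0, s, 0, 0)) a else 0)" for s a b
  have "f (0, s, t, q) = bipoly M (c s) t q" if M: "M \<ge> max d (Max (e ` {..d}))" for M s t q
  proof -
    have "coeff (p (0, s, t, 0)) b = (\<Sum>a\<le>M. c s a b * t ^ a)" if "b \<le> M" for b
    proof (cases "b \<le> d")
      case True
      have "e b \<le> Max (e ` {..d})" using True by (intro Max_ge) auto
      then have "degree (r b (0, s, 0, 0)) \<le> M"
        using poly_familyD(1)[OF r(1), of b "(0, s, 0, 0)"] M by linarith
      then show ?thesis
        using r(2)[of "(0, s, 0, 0)" t b] True by (simp add: c_def poly_eq_sum_atMost)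
    next
      case False
      then have "coeff (p (0, s, t, 0)) b = 0"
        using poly_familyD(1)[OF p(1), of "(0, s, t, 0)"] by (intro coeff_eq_0) simp
      then show ?thesis using False by (simp add: c_def)
    qed
    note coeffs = this
    have "degree (p (0, s, t, 0)) \<le> M" using poly_familyD(1)[OF p(1), of "(0, s, t, 0)"] M by simp
    then have "f (0, s, t, q) = (\<Sum>b\<le>M. coeff (p (0, s, t, 0)) b * q ^ b)"
      using p(2)[of "(0, s, t, 0)" q] by (simp add: poly_eq_sum_atMost)
    also have "\<dots> = (\<Sum>b\<le>M. \<Sum>a\<le>M. c s a b * t ^ a * q ^ b)"
      by (intro sum.cong refl) (simp add: coeffs sum_distrib_right)
    also have "\<dots> = bipoly M (c s) t q" unfolding bipoly_def by (rule sum.swap)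
    finally show ?thesis .
  qed
  then show ?thesis by blast
qed

text \<open>The bound \<open>N\<close> on the degrees does not depend on the radius.\<close>

lemma sublevel_sets_determined:
  fixes f g :: "'a::euclidean_space \<Rightarrow> real"
  assumes "real_polynomial_function f" "real_polynomial_function g"
  shows "\<exists>N C. finite C \<and> (\<forall>s t q q'.
    (\<forall>c\<in>C. sgn (bipoly N (c s) t q) = sgn (bipoly N (c s) t q')) \<longrightarrow>
    (\<exists>v. norm v ^ 2 \<le> s \<and> t \<le> f v \<and> g v \<le> q) \<longrightarrow> (\<exists>v. norm v ^ 2 \<le> s \<and> t \<le> f v \<and> g v \<le> q'))"
proof -
  \<comment> \<open>The radius enters through its square \<open>s\<close>, because
    \<open>norm v ^ 2\<close> is polynomial in \<open>v\<close> and \<open>norm v\<close> is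
    not.\<close>
  define S :: "('a \<times> real \<times> real \<times> real) set"
    where "S = {(v, s, t, q). norm v ^ 2 \<le> s \<and> t \<le> f v \<and> g v \<le> q}"
  have fst: "real_polynomial_function (\<lambda>x. k (fst x))" if "real_polynomial_function k"
    for k :: "'a \<Rightarrow> real"
    using real_polynomial_function_compose[OF polynomial_function_bounded_linear[OF bounded_linear_fst] that]
    by (simp add: o_def)
  have "real_polynomial_function (\<lambda>v::'a. norm v ^ 2)"
    unfolding power2_norm_eq_inner
    by (subst euclidean_inner)
      (intro real_polynomial_function_sum finite_Basis real_polynomial_function_mult
        real_polynomial_function.intros(1) bounded_linear_inner_left)
  note n = fst[OF this] and f = fst[OF assms(1)] and g = fst[OF assms(2)]
  define F :: "('a \<times> real \<times> real \<times> real \<Rightarrow> real) set" where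
    "F = {\<lambda>x. fst (snd x) - norm (fst x) ^ 2, \<lambda>x. f (fst x) - fst (snd (snd x)), \<lambda>x. snd (snd (snd x)) - g (fst x)}"
  have "real_polynomial_function (\<lambda>x::'a \<times> real \<times> real \<times> real. fst (snd x))"
    "real_polynomial_function (\<lambda>x::'a \<times> real \<times> real \<times> real. fst (snd (snd x)))"
    "real_polynomial_function (\<lambda>x::'a \<times> real \<times> real \<times> real. snd (snd (snd x)))"
    by (intro real_polynomial_function.intros(1) bounded_linear_intros)+
  then have "\<forall>k\<in>F. real_polynomial_function k"
    using n f g by (auto simp: F_def intro!: real_polynomial_function_diff)
  moreover have "x' \<in> S" if "\<forall>k\<in>F. sgn (k x) = sgn (k x')" "x \<in> S" for x x'
  proof -
    have nonneg: "0 \<le> u'" if "sgn u = sgn u'" "0 \<le> u" for u u' :: real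
      using that by (metis sgn_le_0_iff sgn_less linorder_not_le)
    show ?thesis
      using that nonneg[of "fst (snd x) - norm (fst x) ^ 2" "fst (snd x') - norm (fst x') ^ 2"]
        nonneg[of "f (fst x) - fst (snd (snd x))" "f (fst x') - fst (snd (snd x'))"]
        nonneg[of "snd (snd (snd x)) - g (fst x)" "snd (snd (snd x')) - g (fst x')"]
      by (simp add: F_def S_def case_prod_beta)
  qed
  ultimately have "semialgebraic S" unfolding semialgebraic_def by (intro exI[of _ F]) (auto simp: F_def)
  \<comment> \<open>Adding all vectors of the first factor to a point \<open>(0, s, t, q)\<close>
    expresses the quantifier over \<open>v\<close>.\<close>
  then have "semialgebraic {x. \<exists>v\<in>span ((\<lambda>v. (v, 0)) ` Basis). x + v \<in> S}"
    by (intro semialgebraic_project_span) auto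
  moreover have "span ((\<lambda>v::'a. (v, 0::real \<times> real \<times> real)) ` Basis) = range (\<lambda>v. (v, 0))"
  proof -
    have "linear (\<lambda>v::'a. (v, 0::real \<times> real \<times> real))" by (auto intro!: linearI)
    then show ?thesis by (simp add: linear_span_image)
  qed
  ultimately obtain G where G: "finite G" "\<And>k. k \<in> G \<Longrightarrow> real_polynomial_function k"
    "\<And>x x'. (\<forall>k\<in>G. sgn (k x) = sgn (k x')) \<Longrightarrow> (\<exists>v. x + (v, 0) \<in> S) \<Longrightarrow> (\<exists>v. x' + (v, 0) \<in> S)"
    unfolding semialgebraic_def by auto
  obtain N c where Nc: "\<And>k M s t q. k \<in> G \<Longrightarrow> M \<ge> N k \<Longrightarrow> k (0, s, t, q) = bipoly M (c k s) t q"
    using real_polynomial_function_bipoly[OF G(2)] by metis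
  define M where "M = Max (insert 0 (N ` G))"
  have "N k \<le> M" if "k \<in> G" for k unfolding M_def using that G(1) by (intro Max_ge) auto
  then have "k (0, s, t, q) = bipoly M (c k s) t q" if "k \<in> G" for k s t q using Nc that by simp
  then have "\<forall>s t q q'. (\<forall>c\<in>c ` G. sgn (bipoly M (c s) t q) = sgn (bipoly M (c s) t q')) \<longrightarrow>
    (\<exists>v. norm v ^ 2 \<le> s \<and> t \<le> f v \<and> g v \<le> q) \<longrightarrow> (\<exists>v. norm v ^ 2 \<le> s \<and> t \<le> f v \<and> g v \<le> q')"
    using G(3)[of "(0, _, _, _)" "(0, _, _, _)"] by (auto simp: S_def)
  then show ?thesis using G(1) by blast
qed

section \<open>Exponents from comparable monomials\<close>

text \<open>The term of largest absolute value is cancelled by the others, so one of them is at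
  least a fixed fraction of it.\<close>

lemma sum_zero_comparable_terms:
  fixes m :: "'i \<Rightarrow> real"
  assumes "finite I" "sum m I = 0" "i0 \<in> I" "m i0 \<noteq> 0"
  shows "\<exists>i\<in>I. \<exists>j\<in>I. i \<noteq> j \<and> m i \<noteq> 0 \<and> m j \<noteq> 0 \<and>
    \<bar>m j\<bar> \<le> \<bar>m i\<bar> \<and> \<bar>m i\<bar> \<le> real (card I) * \<bar>m j\<bar>"
proof -
  define B where "B = Max ((\<lambda>i. \<bar>m i\<bar>) ` I)"
  have "B \<in> (\<lambda>i. \<bar>m i\<bar>) ` I" unfolding B_def using assms(1,3) by (intro Max_in) auto
  then obtain i where i: "i \<in> I" "B = \<bar>m i\<bar>" by auto
  have B: "\<bar>m j\<bar> \<le> \<bar>m i\<bar>" if "j \<in> I" for j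
    unfolding i(2)[symmetric] B_def using that assms(1) by (intro Max_ge) auto
  have "m i \<noteq> 0" using B[OF assms(3)] assms(4) by auto
  have "\<exists>j\<in>I - {i}. \<bar>m i\<bar> \<le> real (card I) * \<bar>m j\<bar>"
  proof (rule ccontr)
    assume "\<not> ?thesis"
    then have small: "real (card I) * \<bar>m j\<bar> \<le> \<bar>m i\<bar>" if "j \<in> I - {i}" for j using that by force
    have "m i = - sum m (I - {i})" using assms(1,2) i(1) by (simp add: sum.remove)
    then have "\<bar>m i\<bar> \<le> (\<Sum>j\<in>I - {i}. \<bar>m j\<bar>)" by (metis abs_minus_cancel sum_abs)
    then have "real (card I) * \<bar>m i\<bar> \<le> (\<Sum>j\<in>I - {i}. real (card I) * \<bar>m j\<bar>)"
      by (simp add: sum_distrib_left[symmetric] mult_left_mono)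
    also have "\<dots> \<le> real (card (I - {i})) * \<bar>m i\<bar>" by (rule sum_bounded_above[OF small])
    also have "\<dots> < real (card I) * \<bar>m i\<bar>"
      using card_Diff1_less[OF assms(1) i(1)] \<open>m i \<noteq> 0\<close>
      by (intro mult_strict_right_mono) simp_all
    finally show False by simp
  qed
  then obtain j where j: "j \<in> I" "j \<noteq> i" "\<bar>m i\<bar> \<le> real (card I) * \<bar>m j\<bar>" by auto
  then have "m j \<noteq> 0" using \<open>m i \<noteq> 0\<close> by auto
  then show ?thesis using i(1) j \<open>m i \<noteq> 0\<close> B[OF j(1)]
    by (intro bexI[of _ i] bexI[of _ j]) simp_all
qed

text \<open>Two terms of the vanishing sum are comparable; dividing by their coefficients costs a
  factor that depends only on \<open>N\<close> and \<open>c\<close>.\<close>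

lemma bipoly_zero_comparable_monomials:
  shows "\<exists>K\<ge>1. \<forall>t>0. \<forall>q>0. (\<exists>a\<le>N. \<exists>b\<le>N. c a b \<noteq> 0) \<longrightarrow> bipoly N c t q = 0 \<longrightarrow>
    (\<exists>a b a' b'. a \<le> N \<and> b \<le> N \<and> a' \<le> N \<and> b' \<le> N \<and> (a, b) \<noteq> (a', b') \<and>
      t ^ a * q ^ b \<le> K * (t ^ a' * q ^ b') \<and> t ^ a' * q ^ b' \<le> K * (t ^ a * q ^ b))"
proof -
  define I where "I = {..N} \<times> {..N}"
  define c' where "c' = case_prod c"
  have finI: "finite I" by (simp add: I_def)
  \<comment> \<open>The sum bounds all ratios of coefficients at once; those with
    \<open>c' i = 0\<close> count as 0. The factor \<open>1 + real (card I)\<close> dominates the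
    constants \<open>card I\<close> and 1 of the two comparisons.\<close>
  define K where "K = 1 + (\<Sum>i\<in>I. \<Sum>j\<in>I. (1 + real (card I)) * (\<bar>c' j\<bar> / \<bar>c' i\<bar>))"
  have term_le: "(1 + real (card I)) * (\<bar>c' j\<bar> / \<bar>c' i\<bar>) \<le> K" if "i \<in> I" "j \<in> I" for i j
  proof -
    have "(1 + real (card I)) * (\<bar>c' j\<bar> / \<bar>c' i\<bar>) \<le> (\<Sum>j\<in>I. (1 + real (card I)) * (\<bar>c' j\<bar> / \<bar>c' i\<bar>))"
      using that finI by (intro member_le_sum) auto
    also have "\<dots> \<le> (\<Sum>i\<in>I. \<Sum>j\<in>I. (1 + real (card I)) * (\<bar>c' j\<bar> / \<bar>c' i\<bar>))"
      using that finI by (intro member_le_sum[of _ _ "\<lambda>i. \<Sum>j\<in>I. (1 + real (card I)) * (\<bar>c' j\<bar> / \<bar>c' i\<bar>)"] sum_nonneg) auto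
    finally show ?thesis by (simp add: K_def)
  qed
  have "K \<ge> 1" by (simp add: K_def sum_nonneg)
  have "\<exists>a b a' b'. a \<le> N \<and> b \<le> N \<and> a' \<le> N \<and> b' \<le> N \<and> (a, b) \<noteq> (a', b') \<and>
      t ^ a * q ^ b \<le> K * (t ^ a' * q ^ b') \<and> t ^ a' * q ^ b' \<le> K * (t ^ a * q ^ b)"
    if tq: "0 < t" "0 < q" and nz: "\<exists>a\<le>N. \<exists>b\<le>N. c a b \<noteq> 0" and z: "bipoly N c t q = 0" for t q
  proof -
    define w where "w i = t ^ fst i * q ^ snd i" for i :: "nat \<times> nat"
    have w: "w i > 0" for i using tq by (simp add: w_def)
    have "(\<Sum>i\<in>I. c' i * w i) = bipoly N c t q"
      by (simp add: bipoly_def I_def c'_def w_def sum.cartesian_product case_prod_beta mult.assoc)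
    then have "(\<Sum>i\<in>I. c' i * w i) = 0" using z by simp
    moreover obtain i0 where "i0 \<in> I" "c' i0 * w i0 \<noteq> 0"
      using nz w by (auto simp: I_def c'_def) (metis less_irrefl)
    ultimately obtain i j where ij: "i \<in> I" "j \<in> I" "i \<noteq> j" "c' i * w i \<noteq> 0" "c' j * w j \<noteq> 0"
      "\<bar>c' j * w j\<bar> \<le> \<bar>c' i * w i\<bar>" "\<bar>c' i * w i\<bar> \<le> real (card I) * \<bar>c' j * w j\<bar>"
      using sum_zero_comparable_terms[OF finI, of "\<lambda>i. c' i * w i"] by blast
    have "w i \<le> real (card I) * (\<bar>c' j\<bar> / \<bar>c' i\<bar>) * w j"
      using ij(4,7) w[of i] w[of j] by (simp add: abs_mult field_simps)
    also have "\<dots> \<le> (1 + real (card I)) * (\<bar>c' j\<bar> / \<bar>c' i\<bar>) * w j"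
      using w[of j] by (intro mult_right_mono) auto
    also have "\<dots> \<le> K * w j" using term_le[OF ij(1,2)] w[of j] by (intro mult_right_mono) auto
    finally have 1: "w i \<le> K * w j" .
    have "w j \<le> 1 * (\<bar>c' i\<bar> / \<bar>c' j\<bar>) * w i"
      using ij(5,6) w[of i] w[of j] by (simp add: abs_mult field_simps)
    also have "\<dots> \<le> (1 + real (card I)) * (\<bar>c' i\<bar> / \<bar>c' j\<bar>) * w i"
      using w[of i] by (intro mult_right_mono) auto
    also have "\<dots> \<le> K * w i" using term_le[OF ij(2,1)] w[of i] by (intro mult_right_mono) auto
    finally have 2: "w j \<le> K * w i" .
    obtain a b a' b' where "i = (a, b)" "j = (a', b')" by (cases i, cases j)
    then show ?thesis using 1 2 ij(1-3) unfolding I_def w_def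
      by (intro exI[of _ a] exI[of _ b] exI[of _ a'] exI[of _ b']) simp
  qed
  then show ?thesis using \<open>K \<ge> 1\<close> by blast
qed

text \<open>For small \<open>t\<close> and \<open>q\<close>, a monomial is not comparable to a
  proper multiple of itself. So the two exponents change in opposite directions, and cancelling
  common powers leaves a power of \<open>t\<close> comparable to a power of
  \<open>q\<close>.\<close>

lemma comparable_monomials_exponents:
  fixes t q K :: real
  assumes "1 \<le> K" "0 < t" "K * t < 1" "0 < q" "K * q < 1" and ne: "(a, b) \<noteq> (a', b')"
    and le: "a \<le> N" "b \<le> N" "a' \<le> N" "b' \<le> N"
    and m: "t ^ a * q ^ b \<le> K * (t ^ a' * q ^ b')" "t ^ a' * q ^ b' \<le> K * (t ^ a * q ^ b)"
  shows "\<exists>p\<in>{1..N}. \<exists>e\<in>{1..N}. t ^ p \<le> K * q ^ e \<and> q ^ e \<le> K * t ^ p"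
proof -
  \<comment> \<open>Each extra factor \<open>x\<close> costs more than \<open>K\<close> gains,
    because \<open>K * x < 1\<close> and \<open>y\<close> is at most 1.\<close>
  have small: False if "x ^ k \<le> K * (x ^ l * y)" "k < l" "0 < x" "K * x < 1" "0 < y" "y \<le> 1"
    for x y :: real and k l
  proof -
    have "l = k + 1 + (l - k - 1)" using that(2) by simp
    then have "x ^ l = x ^ k * x * x ^ (l - k - 1)" by (metis power_add power_one_right)
    moreover have "1 * x \<le> K * x" using that(3) assms(1) by (intro mult_right_mono) auto
    then have "x \<le> 1" using that(4) by linarith
    then have "x ^ (l - k - 1) * y \<le> 1" using that by (intro mult_le_one power_le_one) auto
    ultimately have "K * (x ^ l * y) \<le> K * (x ^ k * x)"
      using that(3) assms(1) mult_left_mono[of "x ^ (l - k - 1) * y" 1 "x ^ k * x"]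
        by (simp add: mult.assoc)
    also have "\<dots> = x ^ k * (K * x)" by simp
    also have "\<dots> < x ^ k * 1" using that(3,4) by (intro mult_strict_left_mono) auto
    finally show False using that(1) by simp
  qed
  have main: "\<exists>p\<in>{1..N}. \<exists>e\<in>{1..N}. t ^ p \<le> K * q ^ e \<and> q ^ e \<le> K * t ^ p"
    if "b' < b" "b \<le> N" "a' \<le> N" "t ^ a * q ^ b \<le> K * (t ^ a' * q ^ b')"
      "t ^ a' * q ^ b' \<le> K * (t ^ a * q ^ b)"
    for a b a' b'
  proof -
    define e where "e = b - b'"
    have b: "q ^ b = q ^ e * q ^ b'" using that(1) by (simp add: e_def flip: power_add)
    have qb: "0 < q ^ b'" using assms by simp
    have 1: "t ^ a * q ^ e \<le> K * t ^ a'" and 2: "t ^ a' \<le> K * (t ^ a * q ^ e)"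
      using that(4,5) qb by (simp_all add: b mult.assoc[symmetric])
    have "a < a'"
    proof (rule ccontr)
      assume "\<not> a < a'"
      then have a: "t ^ a = t ^ (a - a') * t ^ a'" by (simp flip: power_add)
      have "1 * t \<le> K * t" using assms(1,2) by (intro mult_right_mono) auto
      then have "t \<le> 1" using assms(3) by linarith
      then have y: "0 < t ^ (a - a')" "t ^ (a - a') \<le> 1" using assms by (auto simp: power_le_one)
      have "q ^ 0 * t ^ a' \<le> K * (q ^ e * t ^ (a - a')) * t ^ a'" using 2 by (simp add: a mult_ac)
      then have "q ^ 0 \<le> K * (q ^ e * t ^ (a - a'))" by (rule mult_right_le_imp_le) (use assms in simp)
      moreover have "0 < e" using that(1) by (simp add: e_def)
      ultimately show False by (rule small[OF _ _ assms(4,5) y])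
    qed
    then have a': "t ^ a' = t ^ (a' - a) * t ^ a" by (simp flip: power_add)
    have ta: "0 < t ^ a" using assms by simp
    have "q ^ e * t ^ a \<le> K * t ^ (a' - a) * t ^ a" "t ^ (a' - a) * t ^ a \<le> K * q ^ e * t ^ a"
      using 1 2 by (simp_all add: a' mult_ac)
    then have "q ^ e \<le> K * t ^ (a' - a)" "t ^ (a' - a) \<le> K * q ^ e"
      using ta by (simp_all only: mult_le_cancel_right_pos)
    then show ?thesis using \<open>a < a'\<close> that(1-3)
      by (intro bexI[of _ "a' - a"] bexI[of _ e]) (auto simp: e_def)
  qed
  consider "b' < b" | "b < b'" | "b = b'" "a < a'" | "b = b'" "a' < a" using ne by fastforce
  then show ?thesis
  proof cases
    case 1 then show ?thesis by (rule main[OF _ le(2,3) m])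
  next
    case 2 then show ?thesis by (rule main[OF _ le(4,1) m(2,1)])
  next
    case 3
    then have "t ^ a * q ^ b \<le> K * (t ^ a' * 1) * q ^ b" using m(1) by (simp add: mult_ac)
    then have "t ^ a \<le> K * (t ^ a' * 1)" by (rule mult_right_le_imp_le) (use assms in simp)
    then show ?thesis using small[of t a a' 1] 3 assms by simp
  next
    case 4
    then have "t ^ a' * q ^ b \<le> K * (t ^ a * 1) * q ^ b" using m(2) by (simp add: mult_ac)
    then have "t ^ a' \<le> K * (t ^ a * 1)" by (rule mult_right_le_imp_le) (use assms in simp)
    then show ?thesis using small[of t a' a 1] 4 assms by simp
  qed
qed

lemma bipoly_zero_exponents:
  assumes "finite C"
  shows "\<exists>K\<ge>1. \<forall>c\<in>C. \<forall>t q. 0 < t \<longrightarrow> K * t < 1 \<longrightarrow> 0 < q \<longrightarrow> K * q < 1 \<longrightarrow>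
    (\<exists>a\<le>N. \<exists>b\<le>N. c a b \<noteq> 0) \<longrightarrow> bipoly N c t q = 0 \<longrightarrow>
    (\<exists>p\<in>{1..N}. \<exists>e\<in>{1..N}. t ^ p \<le> K * q ^ e \<and> q ^ e \<le> K * t ^ p)"
proof -
  define R where "R c K \<longleftrightarrow> (\<forall>t>0. \<forall>q>0. (\<exists>a\<le>N. \<exists>b\<le>N. c a b \<noteq> 0) \<longrightarrow> bipoly N c t q = 0 \<longrightarrow>
    (\<exists>a b a' b'. a \<le> N \<and> b \<le> N \<and> a' \<le> N \<and> b' \<le> N \<and> (a, b) \<noteq> (a', b') \<and>
      t ^ a * q ^ b \<le> K * (t ^ a' * q ^ b') \<and> t ^ a' * q ^ b' \<le> K * (t ^ a * q ^ b)))" for c K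
  have "\<exists>K\<ge>1. R c K" for c
    unfolding R_def by (rule bipoly_zero_comparable_monomials)
  then obtain k where k: "\<And>c. 1 \<le> k c" "\<And>c. R c (k c)" by metis
  define K where "K = Max (insert 1 (k ` C))"
  have K: "1 \<le> K" "\<And>c. c \<in> C \<Longrightarrow> k c \<le> K" unfolding K_def using assms by (auto intro!: Max_ge)
  have "\<exists>p\<in>{1..N}. \<exists>e\<in>{1..N}. t ^ p \<le> K * q ^ e \<and> q ^ e \<le> K * t ^ p"
    if c: "c \<in> C" "0 < t" "K * t < 1" "0 < q" "K * q < 1" "\<exists>a\<le>N. \<exists>b\<le>N. c a b \<noteq> 0" "bipoly N c t q = 0"
      for c t q
  proof -
    obtain a b a' b' where le: "a \<le> N" "b \<le> N" "a' \<le> N" "b' \<le> N" and ne: "(a, b) \<noteq> (a', b')"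
      and m: "t ^ a * q ^ b \<le> k c * (t ^ a' * q ^ b')" "t ^ a' * q ^ b' \<le> k c * (t ^ a * q ^ b)"
      using k(2)[of c, unfolded R_def, rule_format, OF c(2,4,6,7)] by blast
    have "0 \<le> t ^ i * q ^ j" for i j using c(2,4) by simp
    then have "k c * (t ^ i * q ^ j) \<le> K * (t ^ i * q ^ j)" for i j using K(2)[OF c(1)]
      by (rule mult_right_mono[rotated])
    then have "t ^ a * q ^ b \<le> K * (t ^ a' * q ^ b')" "t ^ a' * q ^ b' \<le> K * (t ^ a * q ^ b)"
      using m by (meson order_trans)+
    then show ?thesis using comparable_monomials_exponents[OF K(1) c(2-5) ne le] by blast
  qed
  then show ?thesis using K(1) by blast
qed

section \<open>The optimal exponent\<close>

lemma isCont_eventually_sgn_eq: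
  fixes h :: "'a::t2_space \<Rightarrow> real"
  assumes "isCont h x" "h x \<noteq> 0"
  shows "\<forall>\<^sub>F y in at x. sgn (h y) = sgn (h x)"
proof (cases "h x > 0")
  case True
  then have "\<forall>\<^sub>F y in at x. h y > 0" using assms(1) by (intro order_tendstoD) (auto simp: isCont_def)
  then show ?thesis using True by (auto elim!: eventually_mono)
next
  case False
  then have neg: "h x < 0" using assms(2) by simp
  then have "\<forall>\<^sub>F y in at x. h y < 0" using assms(1) by (intro order_tendstoD) (auto simp: isCont_def)
  then show ?thesis using neg by (auto elim!: eventually_mono)
qed

text \<open>Otherwise every polynomial in \<open>C\<close> either has only zero coefficients or is
  nonzero at \<open>q0\<close>, so all signs persist slightly to the left of \<open>q0\<close>. Then
  \<open>A\<close> holds below its least element.\<close>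

lemma bipoly_zero_of_threshold:
  assumes "finite C"
    and det: "\<And>q q'. \<forall>c\<in>C. sgn (bipoly N c t q) = sgn (bipoly N c t q') \<Longrightarrow> A q \<Longrightarrow> A q'"
    and q0: "A q0" "\<And>q. A q \<Longrightarrow> q0 \<le> q"
  shows "\<exists>c\<in>C. (\<exists>a\<le>N. \<exists>b\<le>N. c a b \<noteq> 0) \<and> bipoly N c t q0 = 0"
proof (rule ccontr)
  assume *: "\<not> ?thesis"
  have "\<forall>\<^sub>F q in at_left q0. sgn (bipoly N c t q) = sgn (bipoly N c t q0)" if "c \<in> C" for c
  proof (cases "bipoly N c t q0 = 0")
    case True
    then have "c a b = 0" if "a \<le> N" "b \<le> N" for a b using * \<open>c \<in> C\<close> that by blast
    then have "bipoly N c t q = 0" for q unfolding bipoly_def by simp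
    then show ?thesis by simp
  next
    case False
    have "isCont (bipoly N c t) q0" unfolding bipoly_def by (intro continuous_intros)
    then have "\<forall>\<^sub>F q in at q0. sgn (bipoly N c t q) = sgn (bipoly N c t q0)"
      using False by (rule isCont_eventually_sgn_eq)
    then show ?thesis by (auto simp: eventually_at_split)
  qed
  then have "\<forall>\<^sub>F q in at_left q0. \<forall>c\<in>C. sgn (bipoly N c t q) = sgn (bipoly N c t q0)"
    using assms(1) by (intro eventually_ball_finite) auto
  moreover have "\<forall>\<^sub>F q in at_left q0. q < q0"
    by (simp add: eventually_at_filter)
  ultimately have "\<forall>\<^sub>F q in at_left q0. q < q0 \<and> (\<forall>c\<in>C. sgn (bipoly N c t q) = sgn (bipoly N c t q0))"
    by eventually_elim simp
  then obtain q where q: "q < q0" "\<forall>c\<in>C. sgn (bipoly N c t q) = sgn (bipoly N c t q0)"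
    using eventually_happens'[OF trivial_limit_at_left_real] by blast
  then have "A q" using q0(1) by (intro det[of q0 q]) simp
  then show False using q0(2) q(1) by (meson linorder_not_le)
qed

text \<open>The two sides are compared after raising to the power \<open>e'\<close>; since
  \<open>t \<le> 1\<close>, a larger exponent gives a smaller power.\<close>

lemma power_le_of_larger_exponent_ratio:
  fixes t q K :: real
  assumes "0 < t" "t \<le> 1" "0 < q" "1 \<le> K" "0 < e'" "p' * e \<le> p * e'" "t ^ p' \<le> K * q ^ e'"
  shows "t ^ p \<le> K ^ e * q ^ e"
proof -
  have "(t ^ p) ^ e' = t ^ (p * e')" by (simp add: power_mult)
  also have "\<dots> \<le> t ^ (p' * e)" using assms by (intro power_decreasing) auto
  also have "\<dots> = (t ^ p') ^ e" by (simp add: power_mult)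
  also have "\<dots> \<le> (K * q ^ e') ^ e" using assms by (intro power_mono) auto
  also have "\<dots> = K ^ e * (q ^ e) ^ e'" by (simp add: power_mult_distrib mult.commute flip: power_mult)
  also have "\<dots> \<le> (K ^ e) ^ e' * (q ^ e) ^ e'"
    using assms self_le_power[of "K ^ e" e'] by (intro mult_right_mono) auto
  finally have "(t ^ p) ^ e' \<le> (K ^ e * q ^ e) ^ e'" by (simp add: power_mult_distrib)
  then show ?thesis using assms by (simp add: power_mono_iff)
qed

text \<open>Among the exponent pairs that occur along arbitrarily small levels \<open>t\<close>, the one with the largest
  ratio gives a Lojasiewicz inequality, and it is optimal because it occurs arbitrarily often.\<close>

lemma optimal_exponent_exists:
  fixes f g :: "'a::euclidean_space \<Rightarrow> real"
  assumes "finite C" "compact S" "continuous_on S f" "continuous_on S g"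
    and nonneg: "\<And>v. v \<in> S \<Longrightarrow> 0 \<le> f v" "\<And>v. v \<in> S \<Longrightarrow> 0 \<le> g v"
    and zero: "\<And>v. v \<in> S \<Longrightarrow> g v = 0 \<Longrightarrow> f v = 0"
    and inf: "\<And>\<epsilon>. 0 < \<epsilon> \<Longrightarrow> \<exists>v\<in>S. 0 < f v \<and> g v < \<epsilon>"
    and det: "\<And>t q q'. \<forall>c\<in>C. sgn (bipoly N c t q) = sgn (bipoly N c t q') \<Longrightarrow>
      \<exists>v\<in>S. t \<le> f v \<and> g v \<le> q \<Longrightarrow> \<exists>v\<in>S. t \<le> f v \<and> g v \<le> q'"
  shows "\<exists>p\<in>{1..N}. \<exists>e\<in>{1..N}. (\<exists>M. \<forall>v\<in>S. f v ^ p \<le> M * g v ^ e) \<and>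
    (\<exists>\<kappa>>0. \<forall>\<epsilon>>0. \<exists>v\<in>S. g v < \<epsilon> \<and> 0 < f v \<and> \<kappa> * g v ^ e \<le> f v ^ p)"
proof -
  have gpos: "0 < g v" if "v \<in> S" "0 < f v" for v
    using nonneg(2)[OF that(1)] zero[OF that(1)] that(2) by (cases "g v = 0") auto
  obtain v1 where v1: "v1 \<in> S" "0 < f v1" using inf[of 1] by auto
  define t1 where "t1 = f v1"
  \<comment> \<open>The level \<open>t1\<close> is attained in \<open>S\<close>, so up to it the
    compact set over which \<open>g\<close> is minimised is nonempty.\<close>
  have "\<exists>m\<in>S. t \<le> f m \<and> (\<forall>v\<in>S. t \<le> f v \<longrightarrow> g m \<le> g v)" if "t \<le> t1" for t
  proof -
    have "closed (S \<inter> f -` {t..})"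
      using assms(2,3) by (intro continuous_closed_preimage) (auto simp: compact_imp_closed)
    then have "compact (S \<inter> (S \<inter> f -` {t..}))" using assms(2) by (rule compact_Int_closed[rotated])
    then have "compact (S \<inter> f -` {t..})" by (simp add: Int_absorb1)
    moreover have "S \<inter> f -` {t..} \<noteq> {}" using v1 that by (auto simp: t1_def)
    moreover have "continuous_on (S \<inter> f -` {t..}) g" using assms(4) by (rule continuous_on_subset) auto
    ultimately show ?thesis using continuous_attains_inf[of "S \<inter> f -` {t..}" g] by auto
  qed
  then obtain m where m: "\<And>t. t \<le> t1 \<Longrightarrow> m t \<in> S" "\<And>t. t \<le> t1 \<Longrightarrow> t \<le> f (m t)"
    "\<And>t v. t \<le> t1 \<Longrightarrow> v \<in> S \<Longrightarrow> t \<le> f v \<Longrightarrow> g (m t) \<le> g v"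
    by metis
  define \<phi> where "\<phi> t = g (m t)" for t
  have "0 < t1" using v1 by (simp add: t1_def)
  have \<phi>_pos: "0 < \<phi> t" if "0 < t" "t \<le> t1" for t
    unfolding \<phi>_def using that m(1,2)[OF that(2)] by (intro gpos) auto
  have ev: "\<forall>\<^sub>F t in at_right 0. 0 < t \<and> t < \<tau>" if "0 < \<tau>" for \<tau> :: real
    using that by (auto simp: eventually_at_right)
  have \<phi>_small: "\<forall>\<^sub>F t in at_right 0. \<phi> t < \<epsilon>" if "0 < \<epsilon>" for \<epsilon>
  proof -
    obtain v where v: "v \<in> S" "0 < f v" "g v < \<epsilon>" using inf \<open>0 < \<epsilon>\<close> by blast
    have "\<forall>\<^sub>F t in at_right 0. 0 < t \<and> t < min t1 (f v)" using \<open>0 < t1\<close> v(2) by (intro ev) simp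
    then show ?thesis
    proof eventually_elim
      case (elim t)
      then have "g (m t) \<le> g v" using v(1) by (intro m(3)) auto
      then show ?case using v(3) by (simp add: \<phi>_def)
    qed
  qed
  obtain K where K: "1 \<le> K" "\<And>c t q. c \<in> C \<Longrightarrow> 0 < t \<Longrightarrow> K * t < 1 \<Longrightarrow> 0 < q \<Longrightarrow> K * q < 1 \<Longrightarrow>
      (\<exists>a\<le>N. \<exists>b\<le>N. c a b \<noteq> 0) \<Longrightarrow> bipoly N c t q = 0 \<Longrightarrow>
      \<exists>p\<in>{1..N}. \<exists>e\<in>{1..N}. t ^ p \<le> K * q ^ e \<and> q ^ e \<le> K * t ^ p"
    using bipoly_zero_exponents[OF assms(1), of N] by blast
  \<comment> \<open>The level \<open>t\<close> exhibits the exponent pair \<open>k\<close>: the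
    powers of \<open>t\<close> and \<open>\<phi> t\<close> agree up to the factor
    \<open>K\<close>.\<close>
  define band where "band k t \<longleftrightarrow> t ^ fst k \<le> K * \<phi> t ^ snd k \<and> \<phi> t ^ snd k \<le> K * t ^ fst k"
    for k :: "nat \<times> nat" and t
  define I where "I = {1..N} \<times> {1..N}"
  \<comment> \<open>Pairs that occur at arbitrarily small levels; there are some because
    \<open>I\<close> is finite and every small level exhibits a pair.\<close>
  define E where "E = {k\<in>I. \<exists>\<^sub>F t in at_right 0. band k t}"
  have finI: "finite I" by (simp add: I_def)
  have some_band: "\<forall>\<^sub>F t in at_right 0. \<exists>k\<in>I. band k t"
  proof -
    have "0 < min t1 (1 / K)" "0 < 1 / K" using \<open>0 < t1\<close> K(1) by simp_all
    from ev[OF this(1)] \<phi>_small[OF this(2)] show ?thesis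
    proof eventually_elim
      case (elim t)
      then have t: "0 < t" "t \<le> t1" "K * t < 1" "K * \<phi> t < 1" using K(1) by (auto simp: field_simps)
      have "\<exists>c\<in>C. (\<exists>a\<le>N. \<exists>b\<le>N. c a b \<noteq> 0) \<and> bipoly N c t (\<phi> t) = 0"
      proof (rule bipoly_zero_of_threshold[OF assms(1), where A = "\<lambda>q. \<exists>v\<in>S. t \<le> f v \<and> g v \<le> q"])
        show "\<exists>v\<in>S. t \<le> f v \<and> g v \<le> \<phi> t" using m(1,2)[OF t(2)] by (auto simp: \<phi>_def)
        show "\<phi> t \<le> q" if "\<exists>v\<in>S. t \<le> f v \<and> g v \<le> q" for q
          using that m(3)[OF t(2)] by (force simp: \<phi>_def)
      qed (rule det)
      then obtain c where c: "c \<in> C" "\<exists>a\<le>N. \<exists>b\<le>N. c a b \<noteq> 0" "bipoly N c t (\<phi> t) = 0" by blast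
      then show ?case using K(2)[OF c(1) t(1,3) \<phi>_pos[OF t(1,2)] t(4) c(2,3)]
        by (auto simp: I_def band_def)
    qed
  qed
  have "\<exists>\<^sub>F t in at_right 0. \<exists>k\<in>I. band k t"
    using some_band by (rule eventually_frequently[rotated]) simp
  from frequently_bex_finite[OF finI this] have "E \<noteq> {}" by (auto simp: E_def)
  moreover have "finite E" using finI by (simp add: E_def)
  ultimately obtain k where k: "k \<in> E" and k_max: "\<And>j. j \<in> E \<Longrightarrow>
    real (fst j) / real (snd j) \<le> real (fst k) / real (snd k)"
    using Max_in[of "(\<lambda>j. real (fst j) / real (snd j)) ` E"] Max_ge[of "(\<lambda>j. real (fst j) / real (snd j)) ` E"]
    by (metis (no_types, lifting) finite_imageI image_iff image_is_empty)
  obtain p e where pe: "k = (p, e)" "p \<in> {1..N}" "e \<in> {1..N}" using k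
    by (cases k) (auto simp: E_def I_def)
  have ratio: "fst j * e \<le> p * snd j" "0 < snd j" if "j \<in> E" for j
  proof -
    show "0 < snd j" using that by (auto simp: E_def I_def)
    then have "real (fst j * e) \<le> real (p * snd j)" using k_max[OF that] pe by (simp add: field_simps)
    then show "fst j * e \<le> p * snd j" by (simp only: of_nat_le_iff)
  qed
  have "\<forall>\<^sub>F t in at_right 0. \<forall>j\<in>I - E. \<not> band j t"
    using finI by (intro eventually_ball_finite) (auto simp: E_def not_frequently)
  then have "\<forall>\<^sub>F t in at_right 0. \<exists>j\<in>E. band j t"
    using some_band by eventually_elim blast
  \<comment> \<open>The finitely many pairs outside \<open>E\<close> no longer occur at small
    levels. Below \<open>\<tau>0\<close> each level therefore has a pair whose ratio is at most that
    of \<open>k\<close>.\<close>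
  then obtain \<tau>0 where \<tau>0: "0 < \<tau>0" "\<And>t. 0 < t \<Longrightarrow> t < \<tau>0 \<Longrightarrow> \<exists>j\<in>E. band j t"
    unfolding eventually_at_right[OF zero_less_one] by blast
  define \<tau> where "\<tau> = min (min (\<tau>0 / 2) t1) 1"
  have \<tau>: "0 < \<tau>" "\<tau> < \<tau>0" "\<tau> \<le> t1" "\<tau> \<le> 1" using \<tau>0(1) \<open>0 < t1\<close> by (auto simp: \<tau>_def)
  have low: "t ^ p \<le> K ^ e * g v ^ e" if v: "v \<in> S" "t \<le> f v" and t: "0 < t" "t \<le> \<tau>" for t v
  proof -
    obtain j where "j \<in> E" "band j t" using \<tau>0(2)[of t] t \<tau> by auto
    then have "t ^ p \<le> K ^ e * \<phi> t ^ e"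
      using ratio[of j] t \<tau> K(1) \<phi>_pos[of t]
      by (intro power_le_of_larger_exponent_ratio[where p' = "fst j" and e' = "snd j"]) (auto simp: band_def)
    moreover have "\<phi> t ^ e \<le> g v ^ e"
      using m(3)[of t v] v t \<tau> \<phi>_pos[of t] by (intro power_mono) (auto simp: \<phi>_def)
    then have "K ^ e * \<phi> t ^ e \<le> K ^ e * g v ^ e" using K(1) by (intro mult_left_mono) auto
    ultimately show ?thesis by linarith
  qed
  have "compact (f ` S)" using assms(2,3) by (rule compact_continuous_image[rotated])
  then obtain F where F: "\<And>v. v \<in> S \<Longrightarrow> f v \<le> F" 
    by (metis bounded_imp_bdd_above compact_imp_bounded bdd_above.E image_eqI)
  \<comment> \<open>Above level \<open>\<tau>\<close> the inequality for \<open>\<tau>\<close>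
    itself is used; the factor \<open>max 1 (F / \<tau>)\<close> covers the distance to the maximum
    of \<open>f\<close>.\<close>
  have "f v ^ p \<le> ((max 1 (F / \<tau>)) ^ p * K ^ e) * g v ^ e" if v: "v \<in> S" for v
  proof (cases "f v = 0")
    case True
    then show ?thesis using pe K(1) nonneg(2)[OF v] by (auto simp: power_0_left)
  next
    case False
    define t where "t = min (f v) \<tau>"
    have fv: "0 < f v" using False nonneg(1)[OF v] by simp
    have "f v \<le> max 1 (F / \<tau>) * t"
    proof (cases "f v \<le> \<tau>")
      case True
      then show ?thesis using fv mult_right_mono[of 1 "max 1 (F / \<tau>)" "f v"] by (simp add: t_def)
    next
      case False
      have "F = F / \<tau> * \<tau>" using \<tau>(1) by simp
      also have "\<dots> \<le> max 1 (F / \<tau>) * \<tau>" using \<tau>(1) by (intro mult_right_mono) auto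
      finally have "f v \<le> max 1 (F / \<tau>) * \<tau>" using F[OF v] by (rule order_trans[rotated])
      moreover have "t = \<tau>" using False by (simp add: t_def)
      ultimately show ?thesis by (simp only:)
    qed
    then have "f v ^ p \<le> (max 1 (F / \<tau>) * t) ^ p" using fv by (intro power_mono) auto
    also have "\<dots> = max 1 (F / \<tau>) ^ p * t ^ p" by (rule power_mult_distrib)
    also have "\<dots> \<le> max 1 (F / \<tau>) ^ p * (K ^ e * g v ^ e)"
      using low[OF v, of t] fv \<tau>(1) by (intro mult_left_mono) (auto simp: t_def)
    finally show ?thesis by (simp add: mult.assoc)
  qed
  \<comment> \<open>At the small levels that exhibit \<open>k\<close>, the minimisers
    \<open>m t\<close> show that the exponents are sharp.\<close>
  moreover have "\<exists>v\<in>S. g v < \<epsilon> \<and> 0 < f v \<and> 1 / K * g v ^ e \<le> f v ^ p" if \<epsilon>: "0 < \<epsilon>" for \<epsilon>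
  proof -
    have "\<exists>\<^sub>F t in at_right 0. band k t" using k by (simp add: E_def)
    moreover have "\<forall>\<^sub>F t in at_right 0. 0 < t \<and> t < t1 \<and> \<phi> t < \<epsilon>"
      using ev[OF \<open>0 < t1\<close>] \<phi>_small[OF \<epsilon>] by eventually_elim simp
    ultimately have "\<exists>\<^sub>F t in at_right 0. (0 < t \<and> t < t1 \<and> \<phi> t < \<epsilon>) \<and> band k t"
      by (rule frequently_eventually_conj)
    then obtain t where t: "band k t" "0 < t" "t < t1" "\<phi> t < \<epsilon>" using frequently_ex by blast
    have mt: "m t \<in> S" "t \<le> f (m t)" using m(1,2)[of t] t(3) by auto
    have "g (m t) ^ e \<le> K * t ^ p" using t(1) pe(1) by (simp add: band_def \<phi>_def)
    also have "\<dots> \<le> K * f (m t) ^ p" using mt t(2) K(1) by (intro mult_left_mono power_mono) auto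
    finally have "1 / K * g (m t) ^ e \<le> f (m t) ^ p" using K(1) by (simp add: field_simps)
    then show ?thesis using mt t(2,4) by (intro bexI[of _ "m t"]) (auto simp: \<phi>_def)
  qed
  moreover have "0 < 1 / K" using K(1) by simp
  ultimately show ?thesis using pe(2,3) by blast
qed

section \<open>Transfer to the rational function and its extension by zero\<close>

text \<open>On the line from 0 through \<open>x\<close> the polynomial has infinitely many roots.
  Hence \<open>P\<close> is nonzero at points arbitrarily close to 0.\<close>

lemma real_polynomial_function_zero_on_ball:
  fixes f :: "'a::real_normed_vector \<Rightarrow> real"
  assumes "real_polynomial_function f" "0 < r" "\<And>x. norm x < r \<Longrightarrow> f x = 0"
  shows "f x = 0"
proof -
  obtain d p where p: "\<And>z y. f (z + y *\<^sub>R x) = poly (p z) y"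
    using real_polynomial_function_line[OF assms(1), of x] by blast
  have "poly (p 0) y = 0" if "\<bar>y\<bar> < r / (norm x + 1)" for y
  proof -
    have "\<bar>y\<bar> * norm x \<le> \<bar>y\<bar> * (norm x + 1)" by (simp add: mult_left_mono)
    also have "\<dots> < r" using that by (simp add: field_simps add_pos_nonneg)
    finally show ?thesis using assms(3)[of "y *\<^sub>R x"] p[of 0 y] by simp
  qed
  then have "{- (r / (norm x + 1))<..<r / (norm x + 1)} \<subseteq> {y. poly (p 0) y = 0}"
    by (auto simp: abs_less_iff)
  moreover have "infinite {- (r / (norm x + 1))<..<r / (norm x + 1)}"
  proof -
    have "0 < r / (norm x + 1)" using assms(2) by (simp add: add_nonneg_pos)
    then show ?thesis by (intro infinite_Ioo) simp
  qed
  ultimately have "p 0 = 0" using poly_roots_finite finite_subset by blast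
  then show ?thesis using p[of 0 1] by simp
qed

lemma rational_bounded_on_subset:
  "rational_bounded_on P Q B \<Longrightarrow> A \<subseteq> B \<Longrightarrow> rational_bounded_on P Q A"
  unfolding rational_bounded_on_def by blast

text \<open>The power \<open>h ^ e\<close> is the bounded quotient to the power \<open>q0\<close>
  times \<open>P ^ d\<close> with \<open>d > 0\<close>. At a zero of \<open>Q\<close> also
  \<open>P\<close> tends to 0, which squeezes \<open>h\<close> to 0.\<close>

lemma ratio_ext_continuous_of_larger_exponent_ratio:
  fixes P Q :: "real ^ 'n \<Rightarrow> real"
  assumes cont: "continuous_on U P" "continuous_on U Q" and "open U"
    and zero: "\<And>x. x \<in> U \<Longrightarrow> Q x = 0 \<Longrightarrow> P x = 0"
    and bdd: "rational_bounded_on (\<lambda>x. P x ^ (2 * p)) (\<lambda>x. Q x ^ (2 * e)) U"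
    and pe: "0 < e" "0 < q0" "p * q0 < p0 * e"
  shows "continuous_on U (ratio_ext P Q p0 q0)"
proof -
  obtain M0 where M0: "\<And>x. x \<in> U \<Longrightarrow> Q x \<noteq> 0 \<Longrightarrow> \<bar>P x ^ (2 * p) / Q x ^ (2 * e)\<bar> \<le> M0"
    using bdd pe(1) unfolding rational_bounded_on_def zero_set_def by auto
  \<comment> \<open>Truncation at 0 makes the bound below valid also at the zeros of
    \<open>Q\<close>, where \<open>M0\<close> says nothing.\<close>
  define M where "M = max M0 0"
  define h where "h = ratio_ext P Q p0 q0"
  define d where "d = 2 * (p0 * e - p * q0)"
  have h_nonneg: "0 \<le> h x" for x unfolding h_def ratio_ext_def by simp
  have bound: "h x ^ e \<le> M ^ q0 * P x ^ d" if x: "x \<in> U" for x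
  proof (cases "Q x = 0")
    case True
    then have "h x ^ e = 0" using pe(1) by (simp add: h_def ratio_ext_def zero_set_def)
    moreover have "0 \<le> M ^ q0 * P x ^ d" by (simp add: M_def d_def)
    ultimately show ?thesis by (simp only:)
  next
    case False
    have "2 * p0 * e = d + 2 * p * q0" using pe(3) by (simp add: d_def algebra_simps)
    then have "h x ^ e = P x ^ d * (P x ^ (2 * p) / Q x ^ (2 * e)) ^ q0"
      using False by (simp add: h_def ratio_ext_def zero_set_def power_divide mult_ac flip: power_mult power_add)
    also have "\<dots> \<le> P x ^ d * M ^ q0"
      using M0[OF x False] by (intro mult_left_mono power_mono) (auto simp: M_def d_def power_mult)
    finally show ?thesis by (simp add: mult.commute)
  qed
  have "isCont h x" if x: "x \<in> U" for x
  proof (cases "Q x = 0")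
    case False
    have PQ: "isCont P x" "isCont Q x"
      using cont x \<open>open U\<close> by (auto simp: continuous_on_eq_continuous_at)
    have "\<forall>\<^sub>F y in nhds x. Q y \<noteq> 0"
      using PQ(2) False by (simp add: tendsto_imp_eventually_ne isCont_def eventually_nhds_conv_at)
    then have "\<forall>\<^sub>F y in nhds x. h y = P y ^ (2 * p0) / Q y ^ (2 * q0)"
      by eventually_elim (simp add: h_def ratio_ext_def zero_set_def)
    moreover have "isCont (\<lambda>y. P y ^ (2 * p0) / Q y ^ (2 * q0)) x"
      using PQ False by (intro continuous_intros) auto
    ultimately show ?thesis by (simp add: isCont_cong)
  next
    case True
    have "P x = 0" "h x = 0" using zero[OF x True] True by (auto simp: h_def ratio_ext_def zero_set_def)
    have "(P \<longlongrightarrow> 0) (at x)"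
      using cont(1) x \<open>open U\<close> \<open>P x = 0\<close> by (metis continuous_on_eq_continuous_at isCont_def)
    then have "((\<lambda>y. M ^ q0 * P y ^ d) \<longlongrightarrow> M ^ q0 * 0 ^ d) (at x)" by (intro tendsto_intros)
    moreover have "0 < d" using pe(3) by (simp add: d_def)
    ultimately have lim: "((\<lambda>y. M ^ q0 * P y ^ d) \<longlongrightarrow> 0) (at x)" by (simp add: power_0_left)
    have "(h \<longlongrightarrow> 0) (at x)"
    proof (rule order_tendstoI)
      fix a :: real assume "a < 0"
      then show "\<forall>\<^sub>F y in at x. a < h y" using h_nonneg
        by (intro always_eventually allI) (meson less_le_trans)
    next
      fix a :: real assume "0 < a"
      then have "\<forall>\<^sub>F y in at x. M ^ q0 * P y ^ d < a ^ e" using lim by (intro order_tendstoD) auto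
      moreover have "\<forall>\<^sub>F y in at x. y \<in> U" using x \<open>open U\<close> by (rule eventually_at_in_open'[rotated])
      ultimately show "\<forall>\<^sub>F y in at x. h y < a"
      proof eventually_elim
        case (elim y)
        then have "h y ^ e < a ^ e" using bound[of y] by simp
        then show ?case by (rule power_less_imp_less_base) (use \<open>0 < a\<close> in simp)
      qed
    qed
    then show ?thesis using \<open>h x = 0\<close> by (simp add: isCont_def)
  qed
  then show ?thesis using \<open>open U\<close> by (simp add: h_def continuous_on_eq_continuous_at)
qed

text \<open>Points with \<open>Q\<close> tending to 0 accumulate at a zero of \<open>Q\<close> in
  \<open>S\<close>. The function is 0 there but at least \<open>\<kappa>\<close> along the
  sequence.\<close>

lemma ratio_ext_not_continuous:
  fixes P Q :: "real ^ 'n \<Rightarrow> real"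
  assumes "compact S" "S \<subseteq> U" "open U" "continuous_on S Q"
    and "0 < \<kappa>"
    and inf: "\<And>\<epsilon>. 0 < \<epsilon> \<Longrightarrow> \<exists>v\<in>S. Q v ^ 2 < \<epsilon> \<and> Q v \<noteq> 0 \<and> \<kappa> * Q v ^ (2 * e) \<le> P v ^ (2 * p)"
  shows "\<not> continuous_on U (ratio_ext P Q p e)"
proof
  assume cont: "continuous_on U (ratio_ext P Q p e)"
  have "\<exists>v\<in>S. Q v ^ 2 < inverse (real (Suc n)) \<and> Q v \<noteq> 0 \<and> \<kappa> * Q v ^ (2 * e) \<le> P v ^ (2 * p)" for n
    by (rule inf) simp
  then obtain v where v: "\<And>n. v n \<in> S" "\<And>n. Q (v n) ^ 2 < inverse (real (Suc n))" "\<And>n. Q (v n) \<noteq> 0"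
    "\<And>n. \<kappa> * Q (v n) ^ (2 * e) \<le> P (v n) ^ (2 * p)"
    by metis
  obtain l r where l: "l \<in> S" "strict_mono r" "(v \<circ> r) \<longlonglongrightarrow> l"
    using \<open>compact S\<close> v(1) unfolding compact_def by metis
  have "(\<lambda>n. Q (v (r n))) \<longlonglongrightarrow> Q l"
    using continuous_on_tendsto_compose[OF assms(4) l(3) l(1)] v(1) by (simp add: o_def)
  then have "(\<lambda>n. Q (v (r n)) ^ 2) \<longlonglongrightarrow> Q l ^ 2" by (intro tendsto_intros)
  moreover have "(\<lambda>n. Q (v n) ^ 2) \<longlonglongrightarrow> 0"
  proof (rule tendsto_sandwich[OF _ _ tendsto_const LIMSEQ_inverse_real_of_nat])
    show "\<forall>\<^sub>F n in sequentially. Q (v n) ^ 2 \<le> inverse (real (Suc n))"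
      using v(2) by (intro always_eventually allI less_imp_le)
  qed simp
  then have "(\<lambda>n. Q (v (r n)) ^ 2) \<longlonglongrightarrow> 0"
    using LIMSEQ_subseq_LIMSEQ[OF _ l(2)] by (simp add: o_def)
  ultimately have "Q l ^ 2 = 0" by (rule LIMSEQ_unique)
  then have "ratio_ext P Q p e l = 0" by (simp add: ratio_ext_def zero_set_def)
  moreover have "l \<in> U" "\<forall>\<^sub>F n in sequentially. (v \<circ> r) n \<in> U"
    using l(1) v(1) assms(2) by (auto intro!: always_eventually)
  then have "(\<lambda>n. ratio_ext P Q p e (v (r n))) \<longlonglongrightarrow> ratio_ext P Q p e l"
    using continuous_on_tendsto_compose[OF cont l(3)] by (simp add: o_def)
  moreover have "\<kappa> \<le> ratio_ext P Q p e (v n)" for n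
    using v(3,4)[of n] by (simp add: ratio_ext_def zero_set_def pos_le_divide_eq zero_less_power_eq)
  ultimately have "\<kappa> \<le> 0" by (metis LIMSEQ_le_const)
  then show False using \<open>0 < \<kappa>\<close> by simp
qed

section \<open>Existence and uniqueness of the exponent ratio\<close>

theorem theorem5p2:
  fixes P Q :: "real ^ 'n \<Rightarrow> real" and \<Delta> :: "(real ^ 'n) set"
  assumes "real_polynomial_function P" and "real_polynomial_function Q"
    and "P \<noteq> (\<lambda>_. 0)" and "Q \<noteq> (\<lambda>_. 0)"
    and "open \<Delta>"
    and "0 \<in> \<Delta> \<inter> zero_set Q"
    and "\<Delta> \<inter> zero_set Q \<subseteq> \<Delta> \<inter> zero_set P"
  shows "\<exists>(r1::real) (p::nat) (e::nat). r1 > 0 \<and> p > 0 \<and> e > 0 \<and>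
    (\<forall>r. 0 < r \<and> r \<le> r1 \<longrightarrow>
      rational_bounded_on (\<lambda>x. P x ^ (2 * p)) (\<lambda>x. Q x ^ (2 * e)) (ball 0 r) \<and>
      \<not> continuous_on (ball 0 r) (ratio_ext P Q p e)) \<and>
    (\<forall>(p0::nat) (q0::nat). p0 > 0 \<and> q0 > 0 \<and>
      (\<exists>r2::real. r2 > 0 \<and>
        rational_bounded_on (\<lambda>x. P x ^ (2 * p0)) (\<lambda>x. Q x ^ (2 * q0)) (ball 0 r2) \<and>
        (\<forall>r. 0 < r \<and> r \<le> r2 \<longrightarrow> \<not> continuous_on (ball 0 r) (ratio_ext P Q p0 q0)))
      \<longrightarrow> real p0 / real q0 = real p / real e)"
proof -
  obtain r0 where r0: "0 < r0" "ball 0 r0 \<subseteq> \<Delta>"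
    using assms(5,6) by (meson IntD1 openE)
  have zero: "P x = 0" if "x \<in> ball 0 r0" "Q x = 0" for x
    using that r0(2) assms(7) by (auto simp: zero_set_def)
  have Q0: "Q 0 = 0" using assms(6) by (simp add: zero_set_def)
  have cont: "continuous_on U P" "continuous_on U Q" for U
    using assms(1,2) by (auto intro: continuous_on_polymonial_function simp: real_polynomial_function_eq)
  \<comment> \<open>Since \<open>N\<close> is chosen before the radius, the same finite set of
    exponent pairs is available at every radius.\<close>
  obtain N C where C: "finite C" "\<And>s t q q'. \<forall>c\<in>C. sgn (bipoly N (c s) t q) = sgn (bipoly N (c s) t q') \<Longrightarrow>
      \<exists>v. norm v ^ 2 \<le> s \<and> t \<le> P v ^ 2 \<and> Q v ^ 2 \<le> q \<Longrightarrow> \<exists>v. norm v ^ 2 \<le> s \<and> t \<le> P v ^ 2 \<and> Q v ^ 2 \<le> q'"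
    using sublevel_sets_determined[OF real_polynomial_function_power[OF assms(1), of 2]
        real_polynomial_function_power[OF assms(2), of 2]] by (elim exE conjE) (rule that; blast)
  define bdd where "bdd \<rho> k \<longleftrightarrow> (\<exists>M. \<forall>v\<in>cball 0 \<rho>. (P v ^ 2) ^ fst k \<le> M * (Q v ^ 2) ^ snd k)" for \<rho> k
  define opt where "opt \<rho> k \<longleftrightarrow> (\<exists>\<kappa>>0. \<forall>\<epsilon>>0. \<exists>v\<in>cball 0 \<rho>. Q v ^ 2 < \<epsilon> \<and> 0 < P v ^ 2 \<and>
    \<kappa> * (Q v ^ 2) ^ snd k \<le> (P v ^ 2) ^ fst k)" for \<rho> k
  have some: "\<exists>k\<in>{1..N} \<times> {1..N}. bdd \<rho> k \<and> opt \<rho> k" if \<rho>: "0 < \<rho>" "\<rho> < r0" for \<rho>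
  proof -
    have ball: "norm v ^ 2 \<le> \<rho> ^ 2 \<longleftrightarrow> v \<in> cball 0 \<rho>" for v :: "real ^ 'n"
      using \<rho>(1) by (simp add: power_mono_iff)
    have "\<exists>p\<in>{1..N}. \<exists>e\<in>{1..N}. (\<exists>M. \<forall>v\<in>cball 0 \<rho>. (P v ^ 2) ^ p \<le> M * (Q v ^ 2) ^ e) \<and>
      (\<exists>\<kappa>>0. \<forall>\<epsilon>>0. \<exists>v\<in>cball 0 \<rho>. Q v ^ 2 < \<epsilon> \<and> 0 < P v ^ 2 \<and> \<kappa> * (Q v ^ 2) ^ e \<le> (P v ^ 2) ^ p)"
    proof (rule optimal_exponent_exists[where C = "(\<lambda>c. c (\<rho> ^ 2)) ` C"])
      show "\<exists>v\<in>cball 0 \<rho>. 0 < P v ^ 2 \<and> Q v ^ 2 < \<epsilon>" if "0 < \<epsilon>" for \<epsilon>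
      proof -
        have "isCont (\<lambda>x. Q x ^ 2) 0"
          using cont(2)[of UNIV] by (intro continuous_intros) (auto simp: continuous_on_eq_continuous_at)
        then have "(\<lambda>x. Q x ^ 2) \<midarrow>0\<rightarrow> Q 0 ^ 2" unfolding isCont_def .
        then have "\<forall>\<^sub>F x in at 0. Q x ^ 2 < \<epsilon>" by (rule order_tendstoD(2)) (use that Q0 in simp)
        then have "\<forall>\<^sub>F x in nhds 0. Q x ^ 2 < \<epsilon>"
          using that Q0 by (simp add: eventually_nhds_conv_at)
        then obtain \<delta> where \<delta>: "0 < \<delta>" "\<And>x. norm x < \<delta> \<Longrightarrow> Q x ^ 2 < \<epsilon>"
          by (auto simp: eventually_nhds_metric)
        \<comment> \<open>A nonzero polynomial does not vanish on a whole ball, so near 0 there are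
          points with small \<open>Q\<close> and nonzero \<open>P\<close>.\<close>
        have "\<exists>x. norm x < min \<delta> \<rho> \<and> P x \<noteq> 0"
        proof (rule ccontr)
          assume "\<not> ?thesis"
          then have z: "P x = 0" if "norm x < min \<delta> \<rho>" for x using that by blast
          have "0 < min \<delta> \<rho>" using \<delta>(1) \<rho>(1) by simp
          then have "P x = 0" for x
            by (rule real_polynomial_function_zero_on_ball[OF assms(1) _ z])
          then show False using assms(3) by blast
        qed
        then obtain x where "norm x < min \<delta> \<rho>" "P x \<noteq> 0" by blast
        then show ?thesis using \<delta>(2)[of x] by (intro bexI[of _ x]) auto
      qed
      show "P v ^ 2 = 0" if "v \<in> cball 0 \<rho>" "Q v ^ 2 = 0" for v
        using zero[of v] that \<rho> by simp
      fix t q q' assume "\<forall>c\<in>(\<lambda>c. c (\<rho> ^ 2)) ` C. sgn (bipoly N c t q) = sgn (bipoly N c t q')"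
        and "\<exists>v\<in>cball 0 \<rho>. t \<le> P v ^ 2 \<and> Q v ^ 2 \<le> q"
      then show "\<exists>v\<in>cball 0 \<rho>. t \<le> P v ^ 2 \<and> Q v ^ 2 \<le> q'"
        using C(2)[of "\<rho> ^ 2" t q q'] unfolding ball Bex_def by simp
    qed (use C(1) cont in \<open>auto intro!: continuous_intros\<close>)
    then show ?thesis unfolding bdd_def opt_def by force
  qed
  have "\<forall>\<^sub>F \<rho> in at_right 0. \<rho> < r0" using r0(1) by (auto simp: eventually_at_right)
  then have "\<forall>\<^sub>F \<rho> in at_right 0. \<exists>k\<in>{1..N} \<times> {1..N}. 0 < \<rho> \<and> \<rho> < r0 \<and> bdd \<rho> k \<and> opt \<rho> k"
    using eventually_at_right_less[of 0] by eventually_elim (use some in blast)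
  then have "\<exists>\<^sub>F \<rho> in at_right 0. \<exists>k\<in>{1..N} \<times> {1..N}. 0 < \<rho> \<and> \<rho> < r0 \<and> bdd \<rho> k \<and> opt \<rho> k"
    by (rule eventually_frequently[rotated]) simp
  \<comment> \<open>Pigeonhole over the radii: one pair \<open>k\<close> serves for arbitrarily
    small \<open>\<rho>\<close>.\<close>
  from frequently_bex_finite[OF _ this] obtain k where k: "k \<in> {1..N} \<times> {1..N}"
    and freq: "\<exists>\<^sub>F \<rho> in at_right 0. 0 < \<rho> \<and> \<rho> < r0 \<and> bdd \<rho> k \<and> opt \<rho> k"
    by auto
  define p e where "p = fst k" and "e = snd k"
  have pe: "0 < p" "0 < e" using k by (auto simp: p_def e_def)
  \<comment> \<open>Boundedness passes to smaller balls, so one suitable radius suffices.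
    Discontinuity passes to larger ones, so below a smaller \<open>\<rho>\<close> is taken for each
    \<open>r\<close>.\<close>
  obtain r1 where r1: "0 < r1" "r1 < r0" "bdd r1 k" using frequently_ex[OF freq] by blast
  have bounded: "rational_bounded_on (\<lambda>x. P x ^ (2 * p)) (\<lambda>x. Q x ^ (2 * e)) (ball 0 r)" if "r \<le> r1"
    for r
  proof -
    obtain M where M: "\<And>v. v \<in> cball 0 r1 \<Longrightarrow> (P v ^ 2) ^ p \<le> M * (Q v ^ 2) ^ e"
      using r1(3) unfolding bdd_def p_def e_def by blast
    have "\<bar>P x ^ (2 * p) / Q x ^ (2 * e)\<bar> \<le> M" if "x \<in> ball 0 r" "Q x \<noteq> 0" for x
      using M[of x] that \<open>r \<le> r1\<close> by (simp add: power_mult pos_divide_le_eq)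
    then show ?thesis using pe(2) unfolding rational_bounded_on_def zero_set_def
      by (intro exI[of _ M]) auto
  qed
  have discont: "\<not> continuous_on (ball 0 r) (ratio_ext P Q p e)" if "0 < r" for r
  proof -
    have "\<forall>\<^sub>F \<rho> in at_right 0. \<rho> < r" using that by (auto simp: eventually_at_right)
    then obtain \<rho> where \<rho>: "0 < \<rho>" "\<rho> < r0" "\<rho> < r" "opt \<rho> k"
      using frequently_ex[OF frequently_eventually_conj[OF freq]] by blast
    then obtain \<kappa> where \<kappa>: "0 < \<kappa>" "\<And>\<epsilon>. 0 < \<epsilon> \<Longrightarrow> \<exists>v\<in>cball 0 \<rho>. Q v ^ 2 < \<epsilon> \<and> 0 < P v ^ 2 \<and>
      \<kappa> * (Q v ^ 2) ^ e \<le> (P v ^ 2) ^ p" unfolding opt_def p_def e_def by blast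
    show ?thesis
    proof (rule ratio_ext_not_continuous[OF compact_cball _ open_ball cont(2) \<kappa>(1)])
      show "cball 0 \<rho> \<subseteq> ball 0 r" using \<rho>(3) by auto
      show "\<exists>v\<in>cball 0 \<rho>. Q v ^ 2 < \<epsilon> \<and> Q v \<noteq> 0 \<and> \<kappa> * Q v ^ (2 * e) \<le> P v ^ (2 * p)" if "0 < \<epsilon>" for \<epsilon>
        using \<kappa>(2)[OF that] zero \<rho>(2) by (force simp: power_mult)
    qed
  qed
  \<comment> \<open>If the two ratios differed, boundedness for the smaller ratio would make the
    function with the larger ratio continuous on a common ball; the argument is applied in both
    directions.\<close>
  have unique: "real p0 / real q0 = real p / real e"
    if pq: "0 < p0" "0 < q0" and r2: "0 < r2"
      and bdd2: "rational_bounded_on (\<lambda>x. P x ^ (2 * p0)) (\<lambda>x. Q x ^ (2 * q0)) (ball 0 r2)"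
      and discont2: "\<And>r. 0 < r \<Longrightarrow> r \<le> r2 \<Longrightarrow> \<not> continuous_on (ball 0 r) (ratio_ext P Q p0 q0)"
    for p0 q0 r2
  proof -
    define r where "r = min r1 r2"
    have r: "0 < r" "r \<le> r1" "r \<le> r2" "r < r0" using r1(1,2) r2 by (auto simp: r_def)
    have zero': "P x = 0" if "x \<in> ball 0 r" "Q x = 0" for x using zero that r(4) by simp
    have "\<not> p * q0 < p0 * e"
      using ratio_ext_continuous_of_larger_exponent_ratio[OF cont open_ball zero' bounded[OF r(2)] pe(2) pq(2)]
        discont2[OF r(1,3)] by blast
    moreover have "rational_bounded_on (\<lambda>x. P x ^ (2 * p0)) (\<lambda>x. Q x ^ (2 * q0)) (ball 0 r)"
      by (rule rational_bounded_on_subset[OF bdd2]) (use r(3) in auto)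
    then have "\<not> p0 * e < p * q0"
      using ratio_ext_continuous_of_larger_exponent_ratio[OF cont open_ball zero' _ pq(2) pe(2)]
        discont[OF r(1)] by blast
    ultimately have "real (p0 * e) = real (p * q0)" by simp
    then show ?thesis using pe pq by (simp add: field_simps)
  qed
  show ?thesis
  proof (rule exI[of _ r1], rule exI[of _ p], rule exI[of _ e], intro conjI allI impI)
    fix p0 q0 :: nat
    assume "0 < p0 \<and> 0 < q0 \<and> (\<exists>r2>0.
        rational_bounded_on (\<lambda>x. P x ^ (2 * p0)) (\<lambda>x. Q x ^ (2 * q0)) (ball 0 r2) \<and>
        (\<forall>r. 0 < r \<and> r \<le> r2 \<longrightarrow> \<not> continuous_on (ball 0 r) (ratio_ext P Q p0 q0)))"
    then obtain r2 where "0 < p0" "0 < q0" "0 < r2"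
      "rational_bounded_on (\<lambda>x. P x ^ (2 * p0)) (\<lambda>x. Q x ^ (2 * q0)) (ball 0 r2)"
      and "\<And>r. 0 < r \<Longrightarrow> r \<le> r2 \<Longrightarrow> \<not> continuous_on (ball 0 r) (ratio_ext P Q p0 q0)" by blast
    then show "real p0 / real q0 = real p / real e" by (rule unique)
  qed (use r1(1) pe bounded discont in \<open>simp_all\<close>)
qed

end
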